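(* Let $\omega=(\omega_j)_{j\in\mathbb{Z}^3}$ be a real configuration with $\omega_j\in[-b,-a]\cup[f,g]$ for all $j$, where $0<a<b<\infty$ and $0<f<g<\infty$. Let $G_\omega(x,y;z)$ be the resolvent kernel of the $\delta$-interaction Schrödinger operator $H_\omega$ on $L^2(\mathbb{R}^3)$ given in the context. For every $z\in\mathbb{C}$ with $\mathrm{Im}\,z>0$ there exist finite, positive constants $C=C_z$ and $\gamma(z)$, depending on $z$ but not on $x,y,m,n$ below, such that: 1. For all $x,y\in\mathbb{R}^3\setminus\mathbb{Z}^3$ with $\|x-y\|\geq 1$, $$|G_\omega(x,y;z)|\leq\frac{C}{d(x)\,d(y)}\,e^{-\gamma(z)\|x-y\|},\qquad d(x):=\mathrm{dist}(x,\mathbb{Z}^3).$$ 2. For all $m,n\in\mathbb{Z}^3$, $$\int_{C_0}d^3x\int_{C_0}d^3y\ |G_\omega(x+m,y+n;z)|\leq C\,e^{-\gamma(z)\|n-m\|},$$ where $C_0\subset\mathbb{R}^3$ is the closed unit cube centered at the origin.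
   Context: $\|\cdot\|$ is the Euclidean norm and $\mathrm{dist}(x,\mathbb{Z}^3)=\inf_{m\in\mathbb{Z}^3}\|x-m\|$. For $\mathrm{Im}\,z>0$, $G_0(x,y;z)=\frac{1}{4\pi}\frac{e^{i\sqrt{z}\|x-y\|}}{\|x-y\|}$ is the Green's function of $-\Delta$ on $L^2(\mathbb{R}^3)$ (principal branch of the square root). $\Gamma(z,\omega)$ is the operator on $\ell^2(\mathbb{Z}^3)$ with matrix elements $$[\Gamma(z,\omega)]_{ij}=\Big(\frac{1}{\omega_j}-\frac{i\sqrt{z}}{4\pi}\Big)\delta_{ij}-G_0(i,j;z)(1-\delta_{ij}).$$ The operator $H_\omega$, formally $-\Delta+\sum_{j\in\mathbb{Z}^3}\omega_j\delta(x-j)$, is the self-adjoint operator on $L^2(\mathbb{R}^3)$ whose resolvent $(H_\omega-z)^{-1}$ has, for $x\neq y$ and $x,y\notin\mathbb{Z}^3$, the kernel $$G_\omega(x,y;z)=G_0(x,y;z)+\sum_{i,j\in\mathbb{Z}^3}G_0(x,i;z)\,[\Gamma(z,\omega)^{-1}]_{ij}\,G_0(j,y;z).$$ *)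

theory Defs
  imports "HOL-Analysis.Analysis"
begin

definition lat :: "int ^ 3 \<Rightarrow> real ^ 3" where
  "lat m = (\<chi> k. of_int (m $ k))"

abbreviation lattice :: "(real ^ 3) set" where
  "lattice \<equiv> range lat"

definition unit_cube :: "(real ^ 3) set" where
  "unit_cube = cbox (\<chi> k. - 1 / 2) (\<chi> k. 1 / 2)"

(* csqrt is the principal branch, so Im (csqrt z) > 0 whenever Im z > 0. *)
definition G0 :: "real ^ 3 \<Rightarrow> real ^ 3 \<Rightarrow> complex \<Rightarrow> complex" where
  "G0 x y z = 1 / (4 * of_real pi) * (exp (\<i> * csqrt z * of_real (norm (x - y))) / of_real (norm (x - y)))"


subsection \<open>The operator $\Gamma(z,\omega)$ on $\ell^2(\mathbb{Z}^3)$\<close>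

definition ell2 :: "(int ^ 3 \<Rightarrow> complex) set" where
  "ell2 = {u. (\<lambda>i. (cmod (u i))\<^sup>2) summable_on UNIV}"

definition Gamma_mat :: "complex \<Rightarrow> (int ^ 3 \<Rightarrow> real) \<Rightarrow> int ^ 3 \<Rightarrow> int ^ 3 \<Rightarrow> complex" where
  "Gamma_mat z \<omega> i j =
     (if i = j then of_real (1 / \<omega> j) - \<i> * csqrt z / (4 * of_real pi)
      else - G0 (lat i) (lat j) z)"

definition Gamma_op :: "complex \<Rightarrow> (int ^ 3 \<Rightarrow> real) \<Rightarrow> (int ^ 3 \<Rightarrow> complex) \<Rightarrow> (int ^ 3 \<Rightarrow> complex)" where
  "Gamma_op z \<omega> u = (\<lambda>i. \<Sum>\<^sub>\<infinity>j. Gamma_mat z \<omega> i j * u j)"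

(* The matrix of an operator A on ell2 has entries (A e_j)_i; here A is the inverse
   of Gamma_op as a map from ell2 to ell2. *)
definition Gamma_inv_mat :: "complex \<Rightarrow> (int ^ 3 \<Rightarrow> real) \<Rightarrow> int ^ 3 \<Rightarrow> int ^ 3 \<Rightarrow> complex" where
  "Gamma_inv_mat z \<omega> i j = inv_into ell2 (Gamma_op z \<omega>) (\<lambda>k. if k = j then 1 else 0) i"

(* Meaningful for x \<noteq> y and x, y outside the lattice. *)
definition Green_formula ::
    "(int ^ 3 \<Rightarrow> real) \<Rightarrow> real ^ 3 \<Rightarrow> real ^ 3 \<Rightarrow> complex \<Rightarrow> complex" where
  "Green_formula \<omega> x y z =
     G0 x y z + (\<Sum>\<^sub>\<infinity>(i, j). G0 x (lat i) z * Gamma_inv_mat z \<omega> i j * G0 (lat j) y z)"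


subsection \<open>Self-adjoint operators on $L^2(\mathbb{R}^3)$ and their resolvents\<close>

(* Elements of L2 are represented by Borel functions. An unbounded operator is given by its
   graph, which contains all representatives of its elements. *)
type_synonym L2_operator = "((real ^ 3 \<Rightarrow> complex) \<times> (real ^ 3 \<Rightarrow> complex)) set"

definition L2 :: "(real ^ 3 \<Rightarrow> complex) set" where
  "L2 = {u \<in> borel_measurable lborel. integrable lborel (\<lambda>x. (cmod (u x))\<^sup>2)}"

definition L2_inner :: "(real ^ 3 \<Rightarrow> complex) \<Rightarrow> (real ^ 3 \<Rightarrow> complex) \<Rightarrow> complex" where
  "L2_inner u v = (LINT x|lborel. cnj (u x) * v x)"

definition L2_adjoint :: "L2_operator \<Rightarrow> L2_operator" where
  "L2_adjoint H = {(u, v) \<in> L2 \<times> L2. \<forall>(p, q) \<in> H. L2_inner u q = L2_inner v p}"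

definition densely_defined :: "L2_operator \<Rightarrow> bool" where
  "densely_defined H \<longleftrightarrow>
     (\<forall>u\<in>L2. \<forall>e>0. \<exists>p\<in>Domain H. (LINT x|lborel. (cmod (u x - p x))\<^sup>2) < e)"

(* L2_adjoint H is always a linear subspace of L2 \<times> L2, closed under almost everywhere
   equality, and it is single-valued (up to null sets) when H is densely defined; so the
   equation below makes H the graph of a linear operator. *)
definition self_adjoint :: "L2_operator \<Rightarrow> bool" where
  "self_adjoint H \<longleftrightarrow> densely_defined H \<and> L2_adjoint H = H"

(* H - z maps its domain bijectively onto L2, and its inverse is the integral operator with
   kernel K. Note that (H - z) u = v means (u, v + z u) \<in> H. *)
definition has_resolvent_kernel ::
    "L2_operator \<Rightarrow> complex \<Rightarrow> (real ^ 3 \<Rightarrow> real ^ 3 \<Rightarrow> complex) \<Rightarrow> bool" where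
  "has_resolvent_kernel H z K \<longleftrightarrow>
     (\<forall>v\<in>L2. (\<exists>u\<in>L2. (u, \<lambda>x. v x + z * u x) \<in> H) \<and>
        (\<forall>u\<in>L2. (u, \<lambda>x. v x + z * u x) \<in> H \<longleftrightarrow>
           (AE x in lborel. integrable lborel (\<lambda>y. K x y * v y) \<and>
              u x = (LINT y|lborel. K x y * v y))))"

(* H is the operator "-Laplacian + sum_j \<omega>_j delta(x - j)" and G is its Green's function. *)
definition delta_hamiltonian ::
    "(int ^ 3 \<Rightarrow> real) \<Rightarrow> L2_operator \<Rightarrow> (real ^ 3 \<Rightarrow> real ^ 3 \<Rightarrow> complex \<Rightarrow> complex) \<Rightarrow> bool" where
  "delta_hamiltonian \<omega> H G \<longleftrightarrow>
     self_adjoint H \<and>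
     (\<forall>z. Im z > 0 \<longrightarrow>
        has_resolvent_kernel H z (\<lambda>x y. G x y z) \<and>
        (\<forall>x y. x \<noteq> y \<and> x \<notin> lattice \<and> y \<notin> lattice \<longrightarrow> G x y z = Green_formula \<omega> x y z))"

end

(* The imaginary part of -4 pi Gamma(z) has the entries k1 sinc (k1 r) exp (- k2 r), where
   sqrt z = k1 + i k2 and r = |i - j|. The kernel exp (- k2 r) is a positive mixture of Gaussians
   (subordination); Gaussian kernels are positive semidefinite, and on the lattice the narrow ones are
   diagonally dominant, so exp (- k2 r) is bounded below by a positive multiple of the identity. The
   factor sinc (k1 r) is an average of plane waves over the sphere, and multiplication by it preserves
   this lower bound. Hence Gamma(z) is coercive whatever the real configuration is, and the
   Combes-Thomas conjugation by exponential weights, carried out on finite sections of the matrix,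
   gives solutions of Gamma w = e_j that decay exponentially, uniformly in the section; a limit along
   a subsequence yields the decay of the inverse of Gamma(z). Summing the formula for the resolvent
   kernel gives the bounds. *)

theory Submission
  imports Defs "HOL-Probability.Probability" "HOL-Real_Asymp.Real_Asymp"
    "HOL-Library.Diagonal_Subsequence"
begin

subsection \<open>Quadratic forms of kernels\<close>

text \<open>The configuration may change sign and \<open>z\<close> may have any real part, so no
  lower bound on the real part of the form is at hand. The imaginary part is blind to the
  configuration: \<open>1 / \<omega> j\<close> is real, and the remaining diagonal term has exactly
  the imaginary part to which that of the off-diagonal entries tends as r -> 0, so the diagonal fits
  the kernel with sinc 0 = 1. For small k2 the kernel exp (- k2 r) is itself not diagonally
  dominant; hence a window of narrow Gaussians is isolated and all others are merely counted as
  nonnegative. A coercive form restricts to every finite set with the same constant, so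
  invertibility and decay reduce to elimination and finite sums, with constants fixed before the
  section is chosen. Since \<open>Gamma_inv_mat\<close> is read off from \<open>inv_into\<close>,
  the decaying solution can be identified with a column of the inverse only once injectivity on
  \<open>ell2\<close> is known; symmetry of the matrix supplies it. The kernel estimate keeps 1 / |x
  - y| apart from the lattice factors, because the integral over coinciding or adjacent cubes sees
  both kinds of singularity; in dimension three both are integrable.\<close>

text \<open>Vectors have entries in a real inner product space so that complex entries are covered:
  there \<open>inner\<close> is the real part of \<open>cnj (u i) * u j\<close>.\<close>

definition real_form :: "'i set \<Rightarrow> ('i \<Rightarrow> 'i \<Rightarrow> real) \<Rightarrow> ('i \<Rightarrow> 'e::real_inner) \<Rightarrow> real" where
  "real_form S K u = (\<Sum>i\<in>S. \<Sum>j\<in>S. K i j * (u i \<bullet> u j))"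

lemma real_form_cong:
  assumes "\<And>i j. i \<in> S \<Longrightarrow> j \<in> S \<Longrightarrow> K i j = L i j"
  shows "real_form S K u = real_form S L u"
  unfolding real_form_def using assms by (intro sum.cong refl) simp

text \<open>A rank one factor is absorbed into the vector. Every later claim that an entrywise
  product preserves positivity or a lower bound reduces to this identity.\<close>

lemma real_form_rank_one:
  "real_form S (\<lambda>i j. a i * a j * K i j) u = real_form S K (\<lambda>i. a i *\<^sub>R u i)"
  by (simp add: real_form_def mult_ac)

lemma real_form_const: "real_form S (\<lambda>i j. 1) u = (norm (\<Sum>i\<in>S. u i))\<^sup>2"
  unfolding real_form_def power2_norm_eq_inner
  by (simp add: inner_sum_left inner_sum_right inner_commute)

lemma real_form_sum:
  "real_form S (\<lambda>i j. \<Sum>b\<in>B. K b i j) u = (\<Sum>b\<in>B. real_form S (K b) u)"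
proof -
  have "real_form S (\<lambda>i j. \<Sum>b\<in>B. K b i j) u = (\<Sum>i\<in>S. \<Sum>j\<in>S. \<Sum>b\<in>B. K b i j * (u i \<bullet> u j))"
    by (simp add: real_form_def sum_distrib_right)
  also have "\<dots> = (\<Sum>i\<in>S. \<Sum>b\<in>B. \<Sum>j\<in>S. K b i j * (u i \<bullet> u j))"
    by (intro sum.cong refl sum.swap)
  also have "\<dots> = (\<Sum>b\<in>B. real_form S (K b) u)"
    unfolding real_form_def by (rule sum.swap)
  finally show ?thesis .
qed

lemma real_form_cmult: "real_form S (\<lambda>i j. c * K i j) u = c * real_form S K u"
  by (simp add: real_form_def sum_distrib_left mult_ac)

lemma real_form_add:
  "real_form S (\<lambda>i j. K i j + L i j) u = real_form S K u + real_form S L u"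
  by (simp add: real_form_def sum.distrib distrib_right)

text \<open>Schur product argument: expanding one factor of the Gram kernel in coordinates leaves
  rank one multiples of the lower power, so the induction must allow arbitrary
  \<open>u\<close>.\<close>

lemma real_form_inner_power_nonneg:
  fixes x :: "'i \<Rightarrow> 'v::euclidean_space" and u :: "'i \<Rightarrow> 'e::real_inner"
  shows "real_form S (\<lambda>i j. (x i \<bullet> x j) ^ n) u \<ge> 0"
proof (induction n arbitrary: u)
  case 0
  then show ?case by (simp add: real_form_const)
next
  case (Suc n)
  have "real_form S (\<lambda>i j. (x i \<bullet> x j) ^ Suc n) u
      = real_form S (\<lambda>i j. \<Sum>b\<in>Basis. (x i \<bullet> b) * (x j \<bullet> b) * (x i \<bullet> x j) ^ n) u"
    by (subst (1) power_Suc, subst (1) euclidean_inner) (simp add: sum_distrib_right)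
  also have "\<dots> = (\<Sum>b\<in>Basis. real_form S (\<lambda>i j. (x i \<bullet> x j) ^ n) (\<lambda>i. (x i \<bullet> b) *\<^sub>R u i))"
    by (simp add: real_form_sum real_form_rank_one)
  also have "\<dots> \<ge> 0"
    by (intro sum_nonneg Suc.IH)
  finally show ?case .
qed

lemma real_form_sums:
  assumes "\<And>i j. i \<in> S \<Longrightarrow> j \<in> S \<Longrightarrow> (\<lambda>n. K n i j) sums L i j"
  shows "(\<lambda>n. real_form S (K n) u) sums real_form S L u"
  unfolding real_form_def by (intro sums_sum sums_mult2 assms)

text \<open>Up to the rank one factor exp (- t |x|^2) exp (- t |y|^2), the Gaussian is exp (2 t
  x.y), a power series in the Gram kernel with nonnegative coefficients.\<close>

lemma real_form_gaussian_nonneg: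
  fixes x :: "'i \<Rightarrow> 'v::euclidean_space" and u :: "'i \<Rightarrow> 'e::real_inner"
  assumes "t \<ge> 0"
  shows "real_form S (\<lambda>i j. exp (- t * (norm (x i - x j))\<^sup>2)) u \<ge> 0"
proof -
  define v where "v i = exp (- t * (norm (x i))\<^sup>2) *\<^sub>R u i" for i
  have eq: "exp (- t * (norm (x i - x j))\<^sup>2) =
     exp (- t * (norm (x i))\<^sup>2) * exp (- t * (norm (x j))\<^sup>2) * exp (2 * t * (x i \<bullet> x j))" for i j
    unfolding exp_add [symmetric]
    by (simp add: power2_norm_eq_inner inner_diff_left inner_diff_right inner_commute algebra_simps)
  have "real_form S (\<lambda>i j. exp (- t * (norm (x i - x j))\<^sup>2)) u
      = real_form S (\<lambda>i j. exp (2 * t * (x i \<bullet> x j))) v"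
    unfolding v_def eq real_form_rank_one ..
  moreover have "(\<lambda>n. real_form S (\<lambda>i j. (2 * t) ^ n / fact n * (x i \<bullet> x j) ^ n) v) sums
      real_form S (\<lambda>i j. exp (2 * t * (x i \<bullet> x j))) v"
  proof (rule real_form_sums)
    fix i j
    show "(\<lambda>n. (2 * t) ^ n / fact n * (x i \<bullet> x j) ^ n) sums exp (2 * t * (x i \<bullet> x j))"
      using exp_converges [of "2 * t * (x i \<bullet> x j)"]
      by (simp add: power_mult_distrib divide_inverse mult_ac)
  qed
  moreover have "real_form S (\<lambda>i j. (2 * t) ^ n / fact n * (x i \<bullet> x j) ^ n) v \<ge> 0" for n
    unfolding real_form_cmult using assms
    by (intro mult_nonneg_nonneg real_form_inner_power_nonneg) auto
  ultimately show ?thesis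
    using sums_le [OF _ sums_zero, of "\<lambda>n. real_form S (\<lambda>i j. (2 * t) ^ n / fact n * (x i \<bullet> x j) ^ n) v"] by simp
qed

text \<open>Schur test: the product of two entries is split by the arithmetic-geometric mean, and
  symmetry turns column sums into row sums.\<close>

lemma sum_row_bound:
  fixes D :: "'i \<Rightarrow> 'i \<Rightarrow> real"
  assumes sym: "\<And>i j. i \<in> S \<Longrightarrow> j \<in> S \<Longrightarrow> D i j = D j i"
    and nonneg: "\<And>i j. i \<in> S \<Longrightarrow> j \<in> S \<Longrightarrow> D i j \<ge> 0"
    and row: "\<And>i. i \<in> S \<Longrightarrow> (\<Sum>j\<in>S. D i j) \<le> \<delta>"
  shows "(\<Sum>i\<in>S. \<Sum>j\<in>S. D i j * (r i * r j)) \<le> \<delta> * (\<Sum>i\<in>S. (r i)\<^sup>2)"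
proof -
  have "(\<Sum>i\<in>S. \<Sum>j\<in>S. D i j * (r i * r j)) \<le> (\<Sum>i\<in>S. \<Sum>j\<in>S. D i j * ((r i)\<^sup>2 / 2) + D i j * ((r j)\<^sup>2 / 2))"
  proof (intro sum_mono)
    fix i j assume ij: "i \<in> S" "j \<in> S"
    have "r i * r j \<le> (r i)\<^sup>2 / 2 + (r j)\<^sup>2 / 2"
      using sum_squares_bound [of "r i" "r j"] by simp
    then show "D i j * (r i * r j) \<le> D i j * ((r i)\<^sup>2 / 2) + D i j * ((r j)\<^sup>2 / 2)"
      unfolding distrib_left [symmetric] using nonneg [OF ij] by (intro mult_left_mono)
  qed
  also have "\<dots> = (\<Sum>i\<in>S. \<Sum>j\<in>S. D i j * ((r i)\<^sup>2 / 2)) + (\<Sum>i\<in>S. \<Sum>j\<in>S. D i j * ((r j)\<^sup>2 / 2))"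
    by (simp add: sum.distrib)
  also have "(\<Sum>i\<in>S. \<Sum>j\<in>S. D i j * ((r j)\<^sup>2 / 2)) = (\<Sum>j\<in>S. \<Sum>i\<in>S. D j i * ((r j)\<^sup>2 / 2))"
    by (subst sum.swap) (intro sum.cong refl, simp add: sym)
  also have "(\<Sum>i\<in>S. \<Sum>j\<in>S. D i j * ((r i)\<^sup>2 / 2)) + (\<Sum>j\<in>S. \<Sum>i\<in>S. D j i * ((r j)\<^sup>2 / 2))
      = (\<Sum>i\<in>S. (\<Sum>j\<in>S. D i j) * (r i)\<^sup>2)"
    by (simp add: sum_distrib_right sum_distrib_left sum.distrib [symmetric] field_simps)
  also have "\<dots> \<le> (\<Sum>i\<in>S. \<delta> * (r i)\<^sup>2)"
    by (intro sum_mono mult_right_mono row) auto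
  finally show ?thesis
    by (simp add: sum_distrib_left)
qed

lemma real_form_diag_dominant:
  assumes fin: "finite S"
    and sym: "\<And>i j. i \<in> S \<Longrightarrow> j \<in> S \<Longrightarrow> K i j = K j i"
    and diag: "\<And>i. i \<in> S \<Longrightarrow> K i i = 1"
    and row: "\<And>i. i \<in> S \<Longrightarrow> (\<Sum>j\<in>S - {i}. \<bar>K i j\<bar>) \<le> \<delta>"
  shows "real_form S K u \<ge> (1 - \<delta>) * (\<Sum>i\<in>S. (norm (u i))\<^sup>2)"
proof -
  define D where "D i j = (if i = j then 0 else \<bar>K i j\<bar>)" for i j
  have split: "(\<Sum>j\<in>S. K i j * (u i \<bullet> u j)) \<ge> (norm (u i))\<^sup>2 - (\<Sum>j\<in>S. D i j * (norm (u i) * norm (u j)))"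
    if i: "i \<in> S" for i
  proof -
    have "(\<Sum>j\<in>S. K i j * (u i \<bullet> u j)) = (norm (u i))\<^sup>2 + (\<Sum>j\<in>S - {i}. K i j * (u i \<bullet> u j))"
      using i fin diag by (simp add: sum.remove [of S i] power2_norm_eq_inner)
    moreover have "(\<Sum>j\<in>S. D i j * (norm (u i) * norm (u j)))
        = (\<Sum>j\<in>S - {i}. \<bar>K i j\<bar> * (norm (u i) * norm (u j)))"
      using i fin by (subst sum.remove [of S i]) (auto simp: D_def intro!: sum.cong split: if_split_asm)
    moreover have "- (\<Sum>j\<in>S - {i}. \<bar>K i j\<bar> * (norm (u i) * norm (u j)))
        \<le> (\<Sum>j\<in>S - {i}. K i j * (u i \<bullet> u j))"
      unfolding sum_negf [symmetric]
    proof (rule sum_mono)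
      fix j
      have "\<bar>K i j * (u i \<bullet> u j)\<bar> \<le> \<bar>K i j\<bar> * (norm (u i) * norm (u j))"
        unfolding abs_mult by (intro mult_left_mono Cauchy_Schwarz_ineq2) auto
      then show "- (\<bar>K i j\<bar> * (norm (u i) * norm (u j))) \<le> K i j * (u i \<bullet> u j)"
        by linarith
    qed
    ultimately show ?thesis by linarith
  qed
  have "(\<Sum>i\<in>S. \<Sum>j\<in>S. D i j * (norm (u i) * norm (u j))) \<le> \<delta> * (\<Sum>i\<in>S. (norm (u i))\<^sup>2)"
  proof (rule sum_row_bound)
    fix i assume i: "i \<in> S"
    have "(\<Sum>j\<in>S. D i j) = (\<Sum>j\<in>S - {i}. \<bar>K i j\<bar>)"
      using i fin by (subst sum.remove [of S i]) (auto simp: D_def intro!: sum.cong split: if_split_asm)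
    then show "(\<Sum>j\<in>S. D i j) \<le> \<delta>" using row [OF i] by simp
  qed (auto simp: D_def sym)
  moreover have "real_form S K u \<ge> (\<Sum>i\<in>S. (norm (u i))\<^sup>2 - (\<Sum>j\<in>S. D i j * (norm (u i) * norm (u j))))"
    unfolding real_form_def by (intro sum_mono split)
  ultimately show ?thesis
    by (simp add: sum_subtractf algebra_simps)
qed

subsection \<open>Subordination\<close>

text \<open>Completing the square: the squared arguments of \<open>\<Psi>\<close> differ from b^2 t
  + a^2 / (4 t) by - a b and + a b, which the prefactors undo. In the difference the b / (2 s) terms
  cancel and the a / (4 s^3) terms add.\<close>

lemma subordination_deriv:
  fixes a b t :: real and \<Psi> :: "real \<Rightarrow> real"
  assumes "t > 0" and \<Psi>: "\<And>x. (\<Psi> has_real_derivative exp (- x\<^sup>2)) (at x)"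
  shows "((\<lambda>t. exp (- (a * b)) * \<Psi> (b * sqrt t - a / (2 * sqrt t))
            - exp (a * b) * \<Psi> (b * sqrt t + a / (2 * sqrt t)))
    has_real_derivative a / 2 * t powr (- 3 / 2) * exp (- (b\<^sup>2 * t) - a\<^sup>2 / (4 * t))) (at t)"
proof -
  define s where "s = sqrt t"
  have s: "s > 0" "s * s = t" "s\<^sup>2 = t" using assms by (auto simp: s_def)
  have pw: "t powr (- 3 / 2) = 1 / s ^ 3"
  proof -
    have "t powr (- 3 / 2) = (t powr (1/2)) powr (- 3)" by (simp add: powr_powr)
    also have "\<dots> = s powr (- 3)" using assms by (simp add: powr_half_sqrt s_def)
    also have "\<dots> = 1 / s ^ 3" using s(1) by (simp add: powr_minus divide_inverse powr_realpow flip: powr_numeral)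
    finally show ?thesis .
  qed
  have e1: "exp (- (a * b)) * exp (- (b * s - a / (2 * s))\<^sup>2) = exp (- (b\<^sup>2 * t) - a\<^sup>2 / (4 * t))"
    unfolding exp_add [symmetric] using s(1) s(3) [symmetric]
    by (simp add: power2_eq_square field_simps)
  have e2: "exp (a * b) * exp (- (b * s + a / (2 * s))\<^sup>2) = exp (- (b\<^sup>2 * t) - a\<^sup>2 / (4 * t))"
    unfolding exp_add [symmetric] using s(1) s(3) [symmetric]
    by (simp add: power2_eq_square field_simps)
  have d1: "((\<lambda>t. b * sqrt t - a / (2 * sqrt t)) has_real_derivative b / (2 * s) + a / (4 * s ^ 3)) (at t)"
    using assms s unfolding s_def
    by (auto intro!: derivative_eq_intros simp: field_simps power3_eq_cube)
  have d2: "((\<lambda>t. b * sqrt t + a / (2 * sqrt t)) has_real_derivative b / (2 * s) - a / (4 * s ^ 3)) (at t)"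
    using assms s unfolding s_def
    by (auto intro!: derivative_eq_intros simp: field_simps power3_eq_cube)
  have D: "((\<lambda>t. exp (- (a * b)) * \<Psi> (b * sqrt t - a / (2 * sqrt t))
            - exp (a * b) * \<Psi> (b * sqrt t + a / (2 * sqrt t)))
    has_real_derivative exp (- (a * b)) * (exp (- (b * s - a / (2 * s))\<^sup>2) * (b / (2 * s) + a / (4 * s ^ 3)))
       - exp (a * b) * (exp (- (b * s + a / (2 * s))\<^sup>2) * (b / (2 * s) - a / (4 * s ^ 3)))) (at t)"
    unfolding s_def
    by (intro DERIV_diff DERIV_cmult DERIV_chain2 [OF \<Psi>] d1 [unfolded s_def] d2 [unfolded s_def])
  show ?thesis
    by (rule DERIV_cong [OF D], unfold mult.assoc [symmetric] e1 e2 pw) (simp add: algebra_simps)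
qed


text \<open>\<open>\<Psi>\<close> is sqrt pi / 2 times the error function. The limit at + infinity
  is the half-line Gaussian integral; the one at - infinity follows because \<open>\<Psi>\<close> is
  odd.\<close>

lemma gauss_antiderivative:
  obtains \<Psi> :: "real \<Rightarrow> real" where "\<And>x. (\<Psi> has_real_derivative exp (- x\<^sup>2)) (at x)"
    "\<Psi> 0 = 0" "(\<Psi> \<longlongrightarrow> sqrt pi / 2) at_top" "(\<Psi> \<longlongrightarrow> - (sqrt pi / 2)) at_bot"
proof -
  have "\<exists>F. \<forall>x::real. -\<infinity> < ereal x \<longrightarrow> ereal x < \<infinity> \<longrightarrow> (F has_vector_derivative exp (- x\<^sup>2)) (at x)"
    by (rule einterval_antiderivative) auto
  then obtain F where F: "\<And>x::real. (F has_real_derivative exp (- x\<^sup>2)) (at x)"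
    by (auto simp: has_real_derivative_iff_has_vector_derivative)
  define \<Psi> where "\<Psi> x = F x - F 0" for x
  have d: "(\<Psi> has_real_derivative exp (- x\<^sup>2)) (at x)" for x
    unfolding \<Psi>_def by (auto intro!: derivative_eq_intros F)
  have int: "set_integrable lborel {0..} (\<lambda>x::real. exp (- x\<^sup>2))"
    "(LINT x:{0..}|lborel. exp (- x\<^sup>2)) = sqrt pi / 2"
    using gaussian_moment_0 unfolding set_integrable_def set_lebesgue_integral_def
    by (auto simp: has_bochner_integral_iff)
  have "((\<lambda>b. LINT x:{0..b}|lborel. exp (- x\<^sup>2)) \<longlongrightarrow> sqrt pi / 2) at_top"
    unfolding int(2) [symmetric] by (intro tendsto_set_lebesgue_integral_at_top int) auto
  moreover have "\<forall>\<^sub>F b in at_top. (LINT x:{0..b}|lborel. exp (- x\<^sup>2)) = \<Psi> b"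
    using eventually_ge_at_top [of 0]
  proof eventually_elim
    case (elim b)
    have "(LINT x|lborel. exp (- x\<^sup>2) * indicator {0..b} x) = F b - F 0"
      by (rule integral_FTC_Icc_real) (use elim F in auto)
    then show ?case
      by (simp add: \<Psi>_def set_lebesgue_integral_def mult.commute)
  qed
  ultimately have top: "(\<Psi> \<longlongrightarrow> sqrt pi / 2) at_top"
    by (rule Lim_transform_eventually)
  have "((\<lambda>x. \<Psi> x + \<Psi> (- x)) has_real_derivative exp (- x\<^sup>2) + exp (- (- x)\<^sup>2) * (- 1)) (at x)" for x
    by (intro DERIV_add d DERIV_chain2 [OF d]) (auto intro!: derivative_eq_intros)
  then have "\<Psi> x + \<Psi> (- x) = \<Psi> 0 + \<Psi> (- 0)" for x
    by (intro DERIV_isconst_all [where f = "\<lambda>x. \<Psi> x + \<Psi> (- x)"]) simp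
  then have odd: "\<Psi> x = - \<Psi> (- x)" for x
    unfolding eq_neg_iff_add_eq_0 by (simp add: \<Psi>_def)
  have "((\<lambda>x. - \<Psi> (- x)) \<longlongrightarrow> - (sqrt pi / 2)) at_bot"
    by (intro tendsto_minus filterlim_compose [OF top] filterlim_uminus_at_top_at_bot)
  then have "(\<Psi> \<longlongrightarrow> - (sqrt pi / 2)) at_bot"
    by (simp flip: odd)
  then show ?thesis
    using that [of \<Psi>] d top by (simp add: \<Psi>_def)
qed

text \<open>The case \<open>b = 0\<close> is included on purpose: it covers the diagonal of the
  lattice kernel, where the distance is 0, and makes the mixing density itself integrable.\<close>

lemma subordination:
  fixes a b :: real
  assumes "a > 0" "b \<ge> 0"
  defines "h \<equiv> (\<lambda>t. a / 2 * t powr (- 3 / 2) * exp (- (b\<^sup>2 * t) - a\<^sup>2 / (4 * t)))"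
  shows "set_integrable lborel {0<..} h" "(LINT t:{0<..}|lborel. h t) = sqrt pi * exp (- (a * b))"
proof -
  obtain \<Psi> :: "real \<Rightarrow> real" where \<Psi>: "\<And>x. (\<Psi> has_real_derivative exp (- x\<^sup>2)) (at x)"
    "\<Psi> 0 = 0" "(\<Psi> \<longlongrightarrow> sqrt pi / 2) at_top" "(\<Psi> \<longlongrightarrow> - (sqrt pi / 2)) at_bot"
    using gauss_antiderivative by blast
  define U where "U t = exp (- (a * b)) * \<Psi> (b * sqrt t - a / (2 * sqrt t))
            - exp (a * b) * \<Psi> (b * sqrt t + a / (2 * sqrt t))" for t
  define A where "A = exp (- (a * b)) * (- (sqrt pi / 2)) - exp (a * b) * (sqrt pi / 2)"
  define B where "B = sqrt pi * exp (- (a * b)) + A"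
  have U': "(U has_real_derivative h t) (at t)" if "t > 0" for t
    unfolding U_def h_def by (rule subordination_deriv [OF that \<Psi>(1)])
  have "(U \<longlongrightarrow> A) (at_right 0)"
    unfolding U_def [abs_def] A_def
  proof (intro tendsto_intros)
    have "filterlim (\<lambda>t. b * sqrt t - a / (2 * sqrt t)) at_bot (at_right 0)"
      using assms by real_asymp
    then show "((\<lambda>t. \<Psi> (b * sqrt t - a / (2 * sqrt t))) \<longlongrightarrow> - (sqrt pi / 2)) (at_right 0)"
      by (rule filterlim_compose [OF \<Psi>(4)])
    have "filterlim (\<lambda>t. b * sqrt t + a / (2 * sqrt t)) at_top (at_right 0)"
      using assms by real_asymp
    then show "((\<lambda>t. \<Psi> (b * sqrt t + a / (2 * sqrt t))) \<longlongrightarrow> sqrt pi / 2) (at_right 0)"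
      by (rule filterlim_compose [OF \<Psi>(3)])
  qed
  moreover have "(U \<longlongrightarrow> B) at_top"
  \<comment> \<open>For \<open>b = 0\<close> both arguments of \<open>\<Psi>\<close> tend to 0 at
    infinity, for \<open>b > 0\<close> both tend to + infinity; the value \<open>B\<close> is the
    same expression in both cases.\<close>
  proof (cases "b = 0")
    case True
    have L1: "((\<lambda>t. \<Psi> (- (a / (2 * sqrt t)))) \<longlongrightarrow> \<Psi> 0) at_top"
      by (intro isCont_tendsto_compose [OF DERIV_isCont [OF \<Psi>(1)]]) (use assms in real_asymp)
    have L2: "((\<lambda>t. \<Psi> (a / (2 * sqrt t))) \<longlongrightarrow> \<Psi> 0) at_top"
      by (intro isCont_tendsto_compose [OF DERIV_isCont [OF \<Psi>(1)]]) (use assms in real_asymp)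
    show ?thesis
      using tendsto_diff [OF L1 L2] by (simp add: U_def [abs_def] B_def A_def True)
  next
    case False
    then have b: "b > 0" using assms by simp
    have "filterlim (\<lambda>t. b * sqrt t - a / (2 * sqrt t)) at_top at_top"
      using assms b by real_asymp
    moreover have "filterlim (\<lambda>t. b * sqrt t + a / (2 * sqrt t)) at_top at_top"
      using assms b by real_asymp
    ultimately have "(U \<longlongrightarrow> exp (- (a * b)) * (sqrt pi / 2) - exp (a * b) * (sqrt pi / 2)) at_top"
      unfolding U_def [abs_def] by (intro tendsto_intros filterlim_compose [OF \<Psi>(3)])
    then show ?thesis by (simp add: B_def A_def mult.commute)
  qed
  moreover have "isCont h t" if "t > 0" for t
    unfolding h_def using that by (auto intro!: continuous_intros)
  moreover have "h t \<ge> 0" for t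
    unfolding h_def using assms by simp
  ultimately have "set_integrable lborel (einterval 0 \<infinity>) h" "(LBINT x=0..\<infinity>. h x) = B - A"
    by (intro interval_integral_FTC_nonneg [of 0 \<infinity> U h A B];
        simp add: U' zero_ereal_def ereal_tendsto_simps)+
  then show "set_integrable lborel {0<..} h" "(LINT t:{0<..}|lborel. h t) = sqrt pi * exp (- (a * b))"
    by (simp_all add: zero_ereal_def interval_integral_Ioi B_def)
qed

subsection \<open>Exponential kernels on the lattice\<close>

lemma lat_diff: "lat (m - n) = lat m - lat n"
  by (simp add: lat_def vec_eq_iff)

lemma lat_0 [simp]: "lat 0 = 0"
  by (simp add: lat_def vec_eq_iff)

lemma lat_eq_0_iff [simp]: "lat m = 0 \<longleftrightarrow> m = 0"
  by (simp add: lat_def vec_eq_iff)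

lemma inj_lat: "inj lat"
  by (rule injI) (use lat_diff lat_eq_0_iff in \<open>metis eq_iff_diff_eq_0\<close>)

lemma norm_lat_ge_1:
  assumes "m \<noteq> 0"
  shows "norm (lat m) \<ge> 1"
proof -
  obtain k where "m $ k \<noteq> 0" using assms by (auto simp: vec_eq_iff)
  then have "1 \<le> \<bar>lat m $ k\<bar>" by (simp add: lat_def flip: of_int_abs)
  also have "\<dots> \<le> norm (lat m)" by (rule component_le_norm_cart)
  finally show ?thesis .
qed

text \<open>Two geometric series, one for each sign, cover the integers; 0 is counted twice, which
  gives the factor 2.\<close>

lemma sum_exp_int_le:
  fixes P :: "int set" and \<delta> :: real
  assumes "finite P" "\<delta> > 0"
  shows "(\<Sum>k\<in>P. exp (- \<delta> * \<bar>of_int k\<bar>)) \<le> 2 / (1 - exp (- \<delta>))"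
proof -
  define e where "e k = exp (- \<delta> * \<bar>of_int k\<bar>)" for k :: int
  define N where "N = Suc (Max (insert 0 ((nat \<circ> abs) ` P)))"
  have sub: "P \<subseteq> int ` {..<N} \<union> (\<lambda>n. - int n) ` {..<N}"
  proof
    fix k assume "k \<in> P"
    then have "nat \<bar>k\<bar> < N"
      unfolding N_def less_Suc_eq_le using assms(1) by (intro Max_ge) (auto simp: image_iff)
    moreover have "k = int (nat \<bar>k\<bar>) \<or> k = - int (nat \<bar>k\<bar>)" by linarith
    ultimately show "k \<in> int ` {..<N} \<union> (\<lambda>n. - int n) ` {..<N}" by blast
  qed
  have geo: "(\<Sum>n<N. exp (- \<delta>) ^ n) \<le> 1 / (1 - exp (- \<delta>))"
    using assms(2) sum_le_suminf [of "\<lambda>n. exp (- \<delta>) ^ n" "{..<N}"]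
    by (simp add: suminf_geometric summable_geometric)
  have ee: "e (int n) = exp (- \<delta>) ^ n" "e (- int n) = exp (- \<delta>) ^ n" for n
    by (simp_all add: e_def mult_ac flip: exp_of_nat_mult)
  have "(\<Sum>k\<in>P. e k) \<le> (\<Sum>k\<in>int ` {..<N} \<union> (\<lambda>n. - int n) ` {..<N}. e k)"
    by (intro sum_mono2 sub) (auto simp: e_def)
  also have "\<dots> \<le> (\<Sum>k\<in>int ` {..<N}. e k) + (\<Sum>k\<in>(\<lambda>n. - int n) ` {..<N}. e k)"
    by (subst sum.union_inter [symmetric]) (auto simp: e_def intro!: sum_nonneg)
  also have "\<dots> = (\<Sum>n<N. exp (- \<delta>) ^ n) + (\<Sum>n<N. exp (- \<delta>) ^ n)"
    by (subst (1 2) sum.reindex) (auto simp: inj_on_def ee)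
  finally show ?thesis using geo by (simp add: e_def)
qed

text \<open>The sum of the moduli of the three coordinates is at most three times the norm, so the
  exponential is dominated by a product of one-dimensional ones with rate
  \<open>\<gamma> / 3\<close>.\<close>

lemma summable_exp_norm_lat:
  assumes "\<gamma> > 0"
  shows "(\<lambda>m. exp (- \<gamma> * norm (lat m))) summable_on UNIV"
proof (rule nonneg_bdd_above_summable_on)
  define f where "f k = exp (- (\<gamma> / 3) * \<bar>real_of_int k\<bar>)" for k
  define B where "B = 2 / (1 - exp (- (\<gamma> / 3)))"
  have le: "exp (- \<gamma> * norm (lat m)) \<le> (\<Prod>k\<in>UNIV. f (m $ k))" for m
  proof -
    have "(\<Sum>k\<in>UNIV. \<bar>lat m $ k\<bar>) \<le> (\<Sum>k\<in>(UNIV::3 set). norm (lat m))"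
      by (intro sum_mono component_le_norm_cart)
    then have "(\<Sum>k\<in>UNIV. \<bar>real_of_int (m $ k)\<bar>) \<le> 3 * norm (lat m)"
      by (simp add: lat_def)
    then have "\<gamma> / 3 * (\<Sum>k\<in>UNIV. \<bar>real_of_int (m $ k)\<bar>) \<le> \<gamma> / 3 * (3 * norm (lat m))"
      using assms by (intro mult_left_mono) auto
    then show ?thesis
      by (simp add: f_def sum_distrib_left sum_negf flip: exp_sum)
  qed
  show "bdd_above (sum (\<lambda>m. exp (- \<gamma> * norm (lat m))) ` {F. F \<subseteq> UNIV \<and> finite F})"
  proof (rule bdd_aboveI2, clarify)
    fix F :: "(int ^ 3) set" assume F: "finite F"
    define P where "P = (\<Union>k. (\<lambda>m. m $ k) ` F)"
    have P: "finite P" using F by (simp add: P_def)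
    have inj: "inj_on (\<lambda>m k. m $ k) F"
      by (auto simp: inj_on_def vec_eq_iff fun_eq_iff)
    have "(\<Sum>m\<in>F. exp (- \<gamma> * norm (lat m))) \<le> (\<Sum>m\<in>F. \<Prod>k\<in>UNIV. f (m $ k))"
      by (intro sum_mono le)
    \<comment> \<open>Vectors become functions so that the sum over an enclosing box factorises by
      \<open>prod_sum_PiE\<close>.\<close>
    also have "\<dots> = (\<Sum>g\<in>(\<lambda>m k. m $ k) ` F. \<Prod>k\<in>UNIV. f (g k))"
      by (subst sum.reindex [OF inj]) simp
    also have "\<dots> \<le> (\<Sum>g\<in>PiE (UNIV :: 3 set) (\<lambda>k. P). \<Prod>k\<in>UNIV. f (g k))"
      using F by (intro sum_mono2) (auto simp: P_def f_def intro!: finite_PiE prod_nonneg)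
    also have "\<dots> = (\<Prod>k\<in>(UNIV::3 set). \<Sum>p\<in>P. f p)"
      using P by (subst prod_sum_PiE) auto
    also have "\<dots> \<le> (\<Prod>k\<in>(UNIV::3 set). B)"
      using sum_exp_int_le [OF P, of "\<gamma> / 3"] assms
      by (intro prod_mono) (auto simp: f_def B_def intro!: sum_nonneg)
    finally show "(\<Sum>m\<in>F. exp (- \<gamma> * norm (lat m))) \<le> B ^ 3" by simp
  qed
qed auto

definition lat_sum :: "real \<Rightarrow> real" where
  "lat_sum \<gamma> = (\<Sum>\<^sub>\<infinity>m. exp (- \<gamma> * norm (lat m)))"

lemma sum_exp_lat_le:
  assumes "\<gamma> > 0" "finite S"
  shows "(\<Sum>j\<in>S. exp (- \<gamma> * norm (lat i - lat j))) \<le> lat_sum \<gamma>"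
proof -
  have "(\<Sum>j\<in>S. exp (- \<gamma> * norm (lat i - lat j))) = (\<Sum>m\<in>(\<lambda>j. i - j) ` S. exp (- \<gamma> * norm (lat m)))"
    by (subst sum.reindex) (auto simp: inj_on_def lat_diff)
  also have "\<dots> \<le> lat_sum \<gamma>"
    unfolding lat_sum_def
    by (intro finite_sum_le_infsum summable_exp_norm_lat) (use assms in auto)
  finally show ?thesis .
qed

lemma lat_sum_ge_1: "\<gamma> > 0 \<Longrightarrow> lat_sum \<gamma> \<ge> 1"
  using sum_exp_lat_le [of \<gamma> "{0}" 0] by simp

text \<open>Distinct lattice points have distance r >= 1, so t r^2 >= (t - 1) + r for t >= 1.
  Off-diagonal rows thus sum to at most exp (- (t - 1)) times \<open>lat_sum 1\<close>, and the
  threshold for \<open>t\<close> makes this at most 1/2.\<close>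

lemma lattice_gaussian_form_ge:
  fixes u :: "int ^ 3 \<Rightarrow> 'e::real_inner"
  assumes S: "finite S" and t: "t \<ge> 1 + ln (2 * lat_sum 1)"
  shows "real_form S (\<lambda>i j. exp (- t * (norm (lat i - lat j))\<^sup>2)) u \<ge> 1 / 2 * (\<Sum>i\<in>S. (norm (u i))\<^sup>2)"
proof -
  have L: "lat_sum 1 \<ge> 1" by (rule lat_sum_ge_1) simp
  have t1: "t \<ge> 1" using t L ln_ge_zero [of "2 * lat_sum 1"] by linarith
  have row: "(\<Sum>j\<in>S - {i}. \<bar>exp (- t * (norm (lat i - lat j))\<^sup>2)\<bar>) \<le> 1 / 2" for i
  proof -
    have "exp (- t * (norm (lat i - lat j))\<^sup>2) \<le> exp (- (t - 1)) * exp (- 1 * norm (lat i - lat j))"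
      if "j \<noteq> i" for j
    proof -
      have r: "norm (lat i - lat j) \<ge> 1" using norm_lat_ge_1 [of "i - j"] that by (simp add: lat_diff)
      then have "norm (lat i - lat j) \<le> (norm (lat i - lat j))\<^sup>2" by (simp add: self_le_power)
      then have "t * norm (lat i - lat j) \<le> t * (norm (lat i - lat j))\<^sup>2"
        using t1 by (intro mult_left_mono) auto
      moreover have "(t - 1) * 1 \<le> (t - 1) * norm (lat i - lat j)"
        using t1 r by (intro mult_left_mono) auto
      ultimately show ?thesis
        unfolding exp_add [symmetric] by (simp add: algebra_simps)
    qed
    then have "(\<Sum>j\<in>S - {i}. \<bar>exp (- t * (norm (lat i - lat j))\<^sup>2)\<bar>)
        \<le> (\<Sum>j\<in>S - {i}. exp (- (t - 1)) * exp (- 1 * norm (lat i - lat j)))"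
      by (intro sum_mono) auto
    also have "\<dots> \<le> exp (- (t - 1)) * lat_sum 1"
      unfolding sum_distrib_left [symmetric] using S by (intro mult_left_mono sum_exp_lat_le) auto
    also have "exp (- (t - 1)) \<le> exp (- ln (2 * lat_sum 1))" using t by simp
    then have "exp (- (t - 1)) * lat_sum 1 \<le> 1 / (2 * lat_sum 1) * lat_sum 1"
      using L by (intro mult_right_mono) (auto simp: exp_minus field_simps)
    also have "\<dots> = 1 / 2" using L by simp
    finally show ?thesis .
  qed
  have "real_form S (\<lambda>i j. exp (- t * (norm (lat i - lat j))\<^sup>2)) u \<ge> (1 - 1 / 2) * (\<Sum>i\<in>S. (norm (u i))\<^sup>2)"
    by (rule real_form_diag_dominant [OF S]) (use row in \<open>auto simp: norm_minus_commute\<close>)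
  then show ?thesis by simp
qed

text \<open>In the Gaussian mixture only the window \<open>{T..T+1}\<close> is used quantitatively,
  with lower bound 1/2; the remaining Gaussians are estimated from below by 0.\<close>

lemma lattice_exp_form_ge:
  assumes "\<kappa> > 0"
  obtains c where "c > 0"
    "\<And>S (u :: int ^ 3 \<Rightarrow> 'e::real_inner). finite S \<Longrightarrow>
       real_form S (\<lambda>i j. exp (- \<kappa> * norm (lat i - lat j))) u \<ge> c * (\<Sum>i\<in>S. (norm (u i))\<^sup>2)"
proof -
  \<comment> \<open>The fixed rate \<open>\<kappa>\<close> takes the place of \<open>a\<close> in
    the subordination formula and the distance that of \<open>b\<close>; thus, for fixed
    \<open>t\<close>, the integrand is Gaussian in the distance, with weight
    \<open>h 0 t\<close>.\<close>
  define h where "h b t = \<kappa> / 2 * t powr (- 3 / 2) * exp (- (b\<^sup>2 * t) - \<kappa>\<^sup>2 / (4 * t))" for b t :: real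
  define T where "T = 1 + ln (2 * lat_sum 1)"
  have "ln (2 * lat_sum 1) \<ge> 0" using lat_sum_ge_1 [of 1] by (intro ln_ge_zero) linarith
  then have T: "T > 0" by (simp add: T_def)
  note h = subordination [OF assms, folded h_def]
  have h_split: "h b t = h 0 t * exp (- t * b\<^sup>2)" for b t
    by (simp add: h_def mult_ac flip: exp_add)
  have h_pos: "h b t > 0" if "t > 0" for b t using assms that by (simp add: h_def)
  define c0 where "c0 = (LINT t:{T..T+1}|lborel. h 0 t)"
  have sub: "{T..T+1} \<subseteq> {0<..}" using T by auto
  have i0: "set_integrable lborel {T..T+1} (h 0)"
    by (rule set_integrable_subset [OF h(1) [of 0]]) (use sub in auto)
  have c0: "c0 > 0"
  proof -
    have "c0 = integral {T..T+1} (h 0)"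
      unfolding c0_def by (rule set_borel_integral_eq_integral [OF i0])
    also have "\<dots> > integral {T..T+1} (\<lambda>_. 0)"
      by (intro integral_less_real) (use T h_pos assms in \<open>auto simp: h_def intro!: continuous_intros\<close>)
    finally show ?thesis by simp
  qed
  show ?thesis
  proof (rule that [of "c0 / (2 * sqrt pi)"])
    show "c0 / (2 * sqrt pi) > 0" using c0 by simp
    fix S :: "(int ^ 3) set" and u :: "int ^ 3 \<Rightarrow> 'e" assume S: "finite S"
    define r where "r i j = norm (lat i - lat j)" for i j
    define E where "E = (\<Sum>i\<in>S. (norm (u i))\<^sup>2)"
    have E: "E \<ge> 0" by (simp add: E_def sum_nonneg)
    have ih: "integrable lborel (\<lambda>t. indicator {0<..} t *\<^sub>R h (r i j) t * (u i \<bullet> u j))" for i j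
      using h(1) [of "r i j"] unfolding set_integrable_def by (intro integrable_mult_left) (auto simp: r_def)
    have eqf: "indicator {0<..} t *\<^sub>R real_form S (\<lambda>i j. h (r i j) t) u
        = (\<Sum>i\<in>S. \<Sum>j\<in>S. indicator {0<..} t *\<^sub>R h (r i j) t * (u i \<bullet> u j))" for t :: real
      by (simp add: real_form_def sum_distrib_left mult_ac)
    have int: "set_integrable lborel {0<..} (\<lambda>t. real_form S (\<lambda>i j. h (r i j) t) u)"
      unfolding set_integrable_def eqf by (intro Bochner_Integration.integrable_sum ih)
    have eq: "(LINT t:{0<..}|lborel. real_form S (\<lambda>i j. h (r i j) t) u)
        = sqrt pi * real_form S (\<lambda>i j. exp (- (\<kappa> * r i j))) u"
    proof -
      have "(LINT t:{0<..}|lborel. real_form S (\<lambda>i j. h (r i j) t) u)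
          = (\<Sum>i\<in>S. \<Sum>j\<in>S. (LINT t|lborel. indicator {0<..} t *\<^sub>R h (r i j) t * (u i \<bullet> u j)))"
        unfolding set_lebesgue_integral_def eqf
        by (subst Bochner_Integration.integral_sum, intro Bochner_Integration.integrable_sum ih,
            intro sum.cong refl Bochner_Integration.integral_sum ih)
      also have "\<dots> = (\<Sum>i\<in>S. \<Sum>j\<in>S. (LINT t:{0<..}|lborel. h (r i j) t) * (u i \<bullet> u j))"
        unfolding set_lebesgue_integral_def by (subst integral_mult_left_zero) simp
      finally show ?thesis
        by (simp add: h r_def real_form_def sum_distrib_left mult_ac)
    qed
    have ind: "indicator {0<..} t *\<^sub>R (indicator {T..T+1} t * x) = indicator {T..T+1} t *\<^sub>R x"
      for t x :: real using T by (auto simp: indicator_def)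
    have "c0 * (E / 2) = (LINT t:{T..T+1}|lborel. h 0 t * (E / 2))"
      by (simp add: c0_def)
    also have "\<dots> = (LINT t:{0<..}|lborel. indicator {T..T+1} t * (h 0 t * (E / 2)))"
      unfolding set_lebesgue_integral_def ind ..
    also have "\<dots> \<le> (LINT t:{0<..}|lborel. real_form S (\<lambda>i j. h (r i j) t) u)"
    proof (rule set_integral_mono [OF _ int])
      have "set_integrable lborel {T..T+1} (\<lambda>t. h 0 t * (E / 2))"
        using i0 by (intro set_integrable_mult_left) auto
      then show "set_integrable lborel {0<..} (\<lambda>t. indicator {T..T+1} t * (h 0 t * (E / 2)))"
        unfolding set_integrable_def ind .
      fix t :: real assume t: "t \<in> {0<..}"
      have hr: "real_form S (\<lambda>i j. h (r i j) t) u = h 0 t * real_form S (\<lambda>i j. exp (- t * (r i j)\<^sup>2)) u"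
        by (subst h_split) (rule real_form_cmult)
      show "indicator {T..T+1} t * (h 0 t * (E / 2)) \<le> real_form S (\<lambda>i j. h (r i j) t) u"
      proof (cases "t \<in> {T..T+1}")
        case True
        then have "E / 2 \<le> real_form S (\<lambda>i j. exp (- t * (r i j)\<^sup>2)) u"
          using lattice_gaussian_form_ge [OF S, of t u] by (simp add: T_def E_def r_def)
        then show ?thesis using True h_pos [of t 0] t by (simp add: hr)
      next
        case False
        then show ?thesis unfolding hr using h_pos [of t 0] t real_form_gaussian_nonneg [of t S lat u]
          by (simp add: r_def)
      qed
    qed
    finally have "c0 * (E / 2) \<le> sqrt pi * real_form S (\<lambda>i j. exp (- (\<kappa> * r i j))) u"
      unfolding eq .
    then show "c0 / (2 * sqrt pi) * (\<Sum>i\<in>S. (norm (u i))\<^sup>2)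
        \<le> real_form S (\<lambda>i j. exp (- \<kappa> * norm (lat i - lat j))) u"
      by (simp add: E_def [symmetric] r_def field_simps)
  qed
qed

subsection \<open>Averages over the sphere\<close>

text \<open>The derivative of F (c + p) - F c vanishes by periodicity. This will rotate the azimuth
  on the sphere.\<close>

lemma integral_period_shift:
  fixes f :: "real \<Rightarrow> real"
  assumes cont: "\<And>x. isCont f x" and per: "\<And>x. f (x + p) = f x" and p: "p \<ge> 0"
  shows "integral {0..p} (\<lambda>x. f (x + c)) = integral {0..p} f"
proof -
  have "\<exists>F. \<forall>x::real. -\<infinity> < ereal x \<longrightarrow> ereal x < \<infinity> \<longrightarrow> (F has_vector_derivative f x) (at x)"
    by (rule einterval_antiderivative) (auto simp: cont)
  then obtain F where F: "\<And>x::real. (F has_real_derivative f x) (at x)"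
    by (auto simp: has_real_derivative_iff_has_vector_derivative)
  have Fs: "((\<lambda>x. F (x + c)) has_real_derivative f (x + c)) (at x)" for x c
    using F [of "x + c"] by (simp add: DERIV_shift)
  have int: "integral {0..p} (\<lambda>x. f (x + c)) = F (p + c) - F (0 + c)" for c
    using p Fs
    by (intro integral_unique fundamental_theorem_of_calculus [where f = "\<lambda>x. F (x + c)"])
       (auto simp: has_real_derivative_iff_has_vector_derivative intro: has_vector_derivative_at_within)
  have "((\<lambda>c. F (c + p) - F c) has_real_derivative f (c + p) - f c) (at c)" for c
    by (intro DERIV_diff F Fs)
  then have "F (c + p) - F c = F (0 + p) - F 0"
    by (intro DERIV_isconst_all [where f = "\<lambda>c. F (c + p) - F c"]) (simp add: per)
  then show ?thesis
    using int [of c] int [of 0] by (simp add: add_ac)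
qed

section \<open>Moments of the cosine over a period and of the height on the sphere\<close>

definition cos_moment :: "nat \<Rightarrow> real" where
  "cos_moment n = integral {0..2 * pi} (\<lambda>x. cos x ^ n)"

text \<open>The derivative of cos^(n+1) sin has integral 0 over a period.\<close>

lemma cos_moment_rec: "(n + 2) * cos_moment (n + 2) = (n + 1) * cos_moment n"
proof -
  have "((\<lambda>x. (n + 2) * cos x ^ (n + 2) - (n + 1) * cos x ^ n) has_integral
      cos (2 * pi) ^ (n + 1) * sin (2 * pi) - cos 0 ^ (n + 1) * sin 0) {0..2 * pi}"
  proof (rule fundamental_theorem_of_calculus)
    fix x :: real
    have "((\<lambda>x. cos x ^ Suc n * sin x) has_real_derivative
        cos x ^ Suc n * cos x + ((1 + real n) * (- sin x * cos x ^ n)) * sin x) (at x within {0..2 * pi})"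
      by (intro DERIV_mult' DERIV_power_Suc) (auto intro!: derivative_eq_intros)
    then have "((\<lambda>x. cos x ^ (n + 1) * sin x) has_real_derivative
        (n + 1) * cos x ^ n * (- sin x) * sin x + cos x ^ (n + 1) * cos x) (at x within {0..2 * pi})"
      by (simp add: mult_ac add_ac)
    moreover have "(n + 1) * cos x ^ n * (- sin x) * sin x + cos x ^ (n + 1) * cos x
        = (n + 2) * cos x ^ (n + 2) - (n + 1) * cos x ^ n"
    proof -
      have sx: "sin x * sin x = 1 - cos x * cos x"
        using sin_squared_eq [of x] by (simp add: power2_eq_square)
      have step: "(n + 1) * cos x ^ n * (- sin x) * sin x = - ((n + 1) * cos x ^ n * (1 - cos x * cos x))"
        by (simp flip: sx)
      show ?thesis unfolding step by (simp add: algebra_simps)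
    qed
    ultimately show "((\<lambda>x. cos x ^ (n + 1) * sin x) has_vector_derivative
        (n + 2) * cos x ^ (n + 2) - (n + 1) * cos x ^ n) (at x within {0..2 * pi})"
      by (simp add: has_real_derivative_iff_has_vector_derivative)
  qed simp
  then have "integral {0..2 * pi} (\<lambda>x. (n + 2) * cos x ^ (n + 2) - (n + 1) * cos x ^ n) = 0"
    by (simp add: integral_unique)
  moreover have "integral {0..2 * pi} (\<lambda>x. (n + 2) * cos x ^ (n + 2) - (n + 1) * cos x ^ n)
      = (n + 2) * cos_moment (n + 2) - (n + 1) * cos_moment n"
    unfolding cos_moment_def integral_mult_right [symmetric]
    by (rule integral_diff) (intro integrable_continuous_interval continuous_intros)+
  ultimately show ?thesis by (simp add: add.commute)
qed

lemma cos_moment_0: "cos_moment 0 = 2 * pi"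
  by (simp add: cos_moment_def)

lemma cos_moment_odd: "odd n \<Longrightarrow> cos_moment n = 0"
proof (induction n rule: induct_nat_012)
  case 1
  have "((\<lambda>x. cos x) has_integral sin (2 * pi) - sin 0) {0..2 * pi}"
    by (rule fundamental_theorem_of_calculus)
       (auto intro!: derivative_eq_intros simp flip: has_real_derivative_iff_has_vector_derivative)
  then show ?case by (simp add: cos_moment_def integral_unique)
next
  case (ge2 n)
  then show ?case using cos_moment_rec [of n] by simp
qed simp

text \<open>This is the Beta function value B(m + 1, l + 1/2), after the substitution of
  s^2.\<close>

definition beta_moment :: "nat \<Rightarrow> nat \<Rightarrow> real" where
  "beta_moment m l = integral {-1..1} (\<lambda>s. (1 - s\<^sup>2) ^ m * s ^ (2 * l))"

lemma beta_moment_0: "beta_moment 0 l = 2 / (2 * l + 1)"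
proof -
  have "((\<lambda>s. s ^ (2 * l)) has_integral 1 ^ (2 * l + 1) / (2 * l + 1) - (-1) ^ (2 * l + 1) / (2 * l + 1)) {-1..1::real}"
  proof (rule fundamental_theorem_of_calculus)
    fix x :: real
    have "((\<lambda>s. s ^ (2 * l + 1) / (2 * l + 1)) has_real_derivative real (2 * l + 1) * x ^ (2 * l) / (2 * l + 1))
        (at x within {-1..1})"
      using DERIV_power_Suc [OF DERIV_ident, of "2 * l" x "{-1..1}"] by (intro DERIV_cdivide) simp
    then show "((\<lambda>s. s ^ (2 * l + 1) / (2 * l + 1)) has_vector_derivative x ^ (2 * l)) (at x within {-1..1})"
      by (simp add: has_real_derivative_iff_has_vector_derivative)
  qed simp
  then show ?thesis by (simp add: beta_moment_def integral_unique)
qed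

text \<open>Integrate the derivative of (1 - s^2)^(m+1) s^(2 l + 1), which has zero boundary
  values.\<close>

lemma beta_moment_rec:
  "(2 * l + 1) * beta_moment (Suc m) l = 2 * (m + 1) * beta_moment m (Suc l)"
proof -
  let ?f = "\<lambda>s::real. (2 * l + 1) * ((1 - s\<^sup>2) ^ Suc m * s ^ (2 * l)) - 2 * (m + 1) * ((1 - s\<^sup>2) ^ m * s ^ (2 * Suc l))"
  have "(?f has_integral (1 - 1\<^sup>2) ^ Suc m * 1 ^ (2 * l + 1) - (1 - (-1)\<^sup>2) ^ Suc m * (-1) ^ (2 * l + 1)) {-1..1}"
  proof (rule fundamental_theorem_of_calculus)
    fix s :: real
    have "((\<lambda>s. (1 - s\<^sup>2) ^ Suc m * s ^ (2 * l + 1)) has_real_derivative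
        (Suc m) * (1 - s\<^sup>2) ^ m * (- 2 * s) * s ^ (2 * l + 1) + (1 - s\<^sup>2) ^ Suc m * ((2 * l + 1) * s ^ (2 * l)))
        (at s within {-1..1})"
    proof -
      have "((\<lambda>s. (1 - s\<^sup>2) ^ Suc m * s ^ Suc (2 * l)) has_real_derivative
          (1 - s\<^sup>2) ^ Suc m * ((1 + real (2 * l)) * (1 * s ^ (2 * l)))
          + ((1 + real m) * (- 2 * s * (1 - s\<^sup>2) ^ m)) * s ^ Suc (2 * l)) (at s within {-1..1})"
        by (intro DERIV_mult' DERIV_power_Suc) (auto intro!: derivative_eq_intros)
      then show ?thesis by (simp add: mult_ac add_ac)
    qed
    moreover have "(Suc m) * (1 - s\<^sup>2) ^ m * (- 2 * s) * s ^ (2 * l + 1)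
        + (1 - s\<^sup>2) ^ Suc m * ((2 * l + 1) * s ^ (2 * l)) = ?f s"
      by (simp add: algebra_simps)
    ultimately show "((\<lambda>s. (1 - s\<^sup>2) ^ Suc m * s ^ (2 * l + 1)) has_vector_derivative ?f s) (at s within {-1..1})"
      by (simp only: has_real_derivative_iff_has_vector_derivative)
  qed simp
  then have "integral {-1..1} ?f = 0"
    by (simp add: integral_unique)
  moreover have "integral {-1..1} ?f = (2 * l + 1) * beta_moment (Suc m) l - 2 * (m + 1) * beta_moment m (Suc l)"
    unfolding beta_moment_def integral_mult_right [symmetric]
    by (rule integral_diff) (intro integrable_continuous_interval continuous_intros)+
  ultimately show ?thesis by (simp add: add.commute)
qed

text \<open>The azimuth and height moments combine so that the even binomial coefficients of order 2
  n turn into those of order n. This lets the sum over \<open>m\<close> in the sphere moment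
  collapse by the binomial theorem into a power of the norm.\<close>

lemma binomial_moments:
  assumes "m \<le> n"
  shows "(2 * n choose (2 * m)) * cos_moment (2 * m) * beta_moment m (n - m)
    = (n choose m) * (4 * pi / (2 * n + 1))"
  using assms
proof (induction m)
  case 0
  then show ?case by (simp add: cos_moment_0 beta_moment_0)
next
  case (Suc m)
  define l where "l = n - Suc m"
  have n: "n = m + l + 1" "n - m = Suc l" "n - Suc m = l" using Suc.prems by (auto simp: l_def)
  define X where "X = real (2 * n choose (2 * m))"
  define X' where "X' = real (2 * n choose (2 * Suc m))"
  define Y where "Y = real (n choose m)"
  define Y' where "Y' = real (n choose Suc m)"
  have IH: "X * cos_moment (2 * m) * beta_moment m (Suc l) = Y * (4 * pi / (2 * n + 1))"
    using Suc by (simp add: X_def Y_def n)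
  have c1: "Suc k * (N choose Suc k) = (N - k) * (N choose k)" for N k
    using binomial_absorb_comp [of N k] binomial_absorption [of k N] by simp
  have "Suc m * (n choose Suc m) = Suc l * (n choose m)"
    using c1 [of m n] n by simp
  then have Y': "real (Suc m) * Y' = real (Suc l) * Y"
    unfolding Y_def Y'_def of_nat_mult [symmetric] by (rule arg_cong)
  have "Suc (Suc (2 * m)) * (2 * n choose Suc (Suc (2 * m))) = (2 * l + 1) * (2 * n choose Suc (2 * m))"
    using c1 [of "Suc (2 * m)" "2 * n"] n by simp
  moreover have "Suc (2 * m) * (2 * n choose Suc (2 * m)) = (2 * l + 2) * (2 * n choose (2 * m))"
    using c1 [of "2 * m" "2 * n"] n by simp
  ultimately have "Suc (2 * m) * (Suc (Suc (2 * m)) * (2 * n choose Suc (Suc (2 * m))))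
      = (2 * l + 1) * ((2 * l + 2) * (2 * n choose (2 * m)))"
    by (metis mult.left_commute)
  then have X': "real (2 * m + 1) * (real (2 * m + 2) * X') = real (2 * l + 1) * (real (2 * l + 2) * X)"
    unfolding X_def X'_def of_nat_mult [symmetric]
    by (intro arg_cong [where f = real]) (simp only: mult_Suc_right add_2_eq_Suc' add_2_eq_Suc flip: Suc_eq_plus1)
  define c where "c = cos_moment (2 * m)"
  define c' where "c' = cos_moment (2 * Suc m)"
  define b where "b = beta_moment m (Suc l)"
  define b' where "b' = beta_moment (Suc m) l"
  have c': "real (2 * m + 2) * c' = real (2 * m + 1) * c"
    using cos_moment_rec [of "2 * m"] by (simp add: c_def c'_def add.commute)
  have b': "real (2 * l + 1) * b' = real (2 * (m + 1)) * b"
    using beta_moment_rec [of l m] by (simp add: b_def b'_def add.commute)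
  define M1 M2 L1 L2 where "M1 = real (2 * m + 1)" "M2 = real (2 * m + 2)" "L1 = real (2 * l + 1)" "L2 = real (2 * l + 2)"
  note defs = this
  have pos: "M1 > 0" "M2 > 0" "L1 > 0" and M2: "M2 = 2 * real (Suc m)" and L2: "L2 = 2 * real (Suc l)"
    by (auto simp: defs)
  \<comment> \<open>Passing from m to m + 1 multiplies the three factors by L1 L2 / (M1 M2), M1 / M2
    and M2 / L1. The product is L2 / M2 = (l + 1) / (m + 1), the quotient of the binomial
    coefficients \<open>Y'\<close> and \<open>Y\<close>.\<close>
  have "X' = L1 * (L2 * X) / (M1 * M2)" using X' [folded defs] pos by (simp add: field_simps)
  moreover have "c' = M1 * c / M2" using c' [folded defs] pos by (simp add: field_simps)
  moreover have "b' = M2 * b / L1" using b' [folded defs] pos by (simp add: defs field_simps)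
  ultimately have "X' * c' * b' = L2 * (X * c * b) / M2"
    using pos by simp
  then have "real (Suc m) * (X' * c' * b') = real (Suc l) * (X * c * b)"
    unfolding L2 M2 by (simp add: field_simps del: of_nat_Suc)
  also have "\<dots> = (real (Suc l) * Y) * (4 * pi / (2 * n + 1))"
    using IH by (simp add: c_def b_def)
  also have "\<dots> = real (Suc m) * (Y' * (4 * pi / (2 * n + 1)))"
    using Y' by simp
  finally have "X' * c' * b' = Y' * (4 * pi / (2 * n + 1))"
    by (simp only: mult_cancel_left) simp
  then show ?case
    by (simp add: n(3) X'_def Y'_def c'_def b'_def)
qed

text \<open>The direction \<open>(sqrt (1 - s\<^sup>2) * cos \<alpha>, sqrt (1 - s\<^sup>2) * sin \<alpha>, s)\<close> runs over the unit
  sphere, and \<open>ds d\<alpha>\<close> is the surface measure (Archimedes).\<close>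

definition sphere_inner :: "real ^ 3 \<Rightarrow> real \<times> real \<Rightarrow> real" where
  "sphere_inner x p = sqrt (1 - (fst p)\<^sup>2) * (x $ 1 * cos (snd p) + x $ 2 * sin (snd p)) + x $ 3 * fst p"

abbreviation sphere_chart :: "(real \<times> real) set" where
  "sphere_chart \<equiv> cbox (-1, 0) (1, 2 * pi)"

lemma sphere_inner_diff: "sphere_inner (x - y) p = sphere_inner x p - sphere_inner y p"
  by (simp add: sphere_inner_def algebra_simps)

lemma continuous_on_sphere_inner [continuous_intros]:
  "continuous_on S (sphere_inner x)"
  unfolding sphere_inner_def by (intro continuous_intros)

lemma sum_even_only:
  fixes h :: "nat \<Rightarrow> real"
  assumes "\<And>k. odd k \<Longrightarrow> h k = 0"
  shows "(\<Sum>k\<le>2 * n. h k) = (\<Sum>m\<le>n. h (2 * m))"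
  by (induction n) (simp_all add: assms)

lemma square_power_commute: "((x :: real)\<^sup>2) ^ k = (x ^ k)\<^sup>2"
  by (simp add: mult.commute flip: power_mult)

lemma integral_cos_binomial:
  "integral {0..2 * pi} (\<lambda>x. (p * cos x + q) ^ (2 * n))
    = (\<Sum>m\<le>n. (2 * n choose (2 * m)) * cos_moment (2 * m) * ((p\<^sup>2) ^ m * (q\<^sup>2) ^ (n - m)))"
proof -
  have "integral {0..2 * pi} (\<lambda>x. (p * cos x + q) ^ (2 * n))
      = integral {0..2 * pi} (\<lambda>x. \<Sum>k\<le>2 * n. (2 * n choose k) * p ^ k * q ^ (2 * n - k) * cos x ^ k)"
    by (simp add: binomial_ring power_mult_distrib mult_ac)
  also have "\<dots> = (\<Sum>k\<le>2 * n. (2 * n choose k) * p ^ k * q ^ (2 * n - k) * cos_moment k)"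
    unfolding cos_moment_def
    by (subst integral_sum) (auto intro!: integrable_continuous_interval continuous_intros)
  also have "\<dots> = (\<Sum>m\<le>n. (2 * n choose (2 * m)) * p ^ (2 * m) * q ^ (2 * n - 2 * m) * cos_moment (2 * m))"
    by (rule sum_even_only) (simp add: cos_moment_odd)
  finally show ?thesis
    unfolding diff_mult_distrib2 [symmetric] by (simp add: power_mult square_power_commute mult_ac)
qed

text \<open>Rotation invariance predicts dependence on the norm alone. It is verified by
  computation: polar form of the first two coordinates, binomial expansion, and the product of the
  azimuth and height moments.\<close>

lemma sphere_moment:
  "integral sphere_chart (\<lambda>p. sphere_inner x p ^ (2 * n)) = 4 * pi * norm x ^ (2 * n) / (2 * n + 1)"
proof -
  obtain r \<beta> where r: "x $ 1 = r * cos \<beta>" "x $ 2 = r * sin \<beta>"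
    using polar_Ex by blast
  have nx: "(norm x)\<^sup>2 = r\<^sup>2 + (x $ 3)\<^sup>2"
  proof -
    have "(norm x)\<^sup>2 = (r * cos \<beta>)\<^sup>2 + (r * sin \<beta>)\<^sup>2 + (x $ 3)\<^sup>2"
      by (simp add: norm_vec_def L2_set_def sum_3 r)
    also have "\<dots> = r\<^sup>2 * ((cos \<beta>)\<^sup>2 + (sin \<beta>)\<^sup>2) + (x $ 3)\<^sup>2"
      by (simp only: power_mult_distrib distrib_left)
    finally show ?thesis by simp
  qed
  have inner: "integral {0..2 * pi} (\<lambda>\<alpha>. sphere_inner x (s, \<alpha>) ^ (2 * n))
      = (\<Sum>m\<le>n. (2 * n choose (2 * m)) * cos_moment (2 * m) * ((r\<^sup>2) ^ m * ((x $ 3)\<^sup>2) ^ (n - m))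
          * ((1 - s\<^sup>2) ^ m * s ^ (2 * (n - m))))" if s: "s \<in> {-1..1}" for s
  proof -
    let ?q = "sqrt (1 - s\<^sup>2)"
    have q: "?q\<^sup>2 = 1 - s\<^sup>2" using s by (auto simp: abs_square_le_1 abs_le_iff)
    \<comment> \<open>The polar angle of the horizontal part enters only as a shift of the azimuth
      and disappears on integrating over a period.\<close>
    have "sphere_inner x (s, \<alpha>) = (?q * r) * cos (\<alpha> + - \<beta>) + x $ 3 * s" for \<alpha>
      by (simp add: sphere_inner_def r cos_diff algebra_simps)
    then have "integral {0..2 * pi} (\<lambda>\<alpha>. sphere_inner x (s, \<alpha>) ^ (2 * n))
        = integral {0..2 * pi} (\<lambda>\<alpha>. ((?q * r) * cos (\<alpha> + - \<beta>) + x $ 3 * s) ^ (2 * n))"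
      by simp
    also have "\<dots> = integral {0..2 * pi} (\<lambda>\<alpha>. ((?q * r) * cos \<alpha> + x $ 3 * s) ^ (2 * n))"
      by (rule integral_period_shift) auto
    also have "\<dots> = (\<Sum>m\<le>n. (2 * n choose (2 * m)) * cos_moment (2 * m) *
        (((?q * r)\<^sup>2) ^ m * ((x $ 3 * s)\<^sup>2) ^ (n - m)))"
      by (rule integral_cos_binomial)
    finally show ?thesis
      by (simp add: power_mult_distrib q power_mult square_power_commute mult_ac)
  qed
  have "integral sphere_chart (\<lambda>p. sphere_inner x p ^ (2 * n))
      = integral {-1..1} (\<lambda>s. integral {0..2 * pi} (\<lambda>\<alpha>. sphere_inner x (s, \<alpha>) ^ (2 * n)))"
    by (subst integral_prod_continuous) (auto intro!: continuous_intros)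
  also have "\<dots> = integral {-1..1} (\<lambda>s. \<Sum>m\<le>n. (2 * n choose (2 * m)) * cos_moment (2 * m)
      * ((r\<^sup>2) ^ m * ((x $ 3)\<^sup>2) ^ (n - m)) * ((1 - s\<^sup>2) ^ m * s ^ (2 * (n - m))))"
    by (intro integral_cong inner)
  also have "\<dots> = (\<Sum>m\<le>n. (2 * n choose (2 * m)) * cos_moment (2 * m)
      * ((r\<^sup>2) ^ m * ((x $ 3)\<^sup>2) ^ (n - m)) * beta_moment m (n - m))"
    unfolding beta_moment_def
    by (subst integral_sum) (auto intro!: integrable_continuous_interval continuous_intros)
  also have "\<dots> = (\<Sum>m\<le>n. (n choose m) * (r\<^sup>2) ^ m * ((x $ 3)\<^sup>2) ^ (n - m) * (4 * pi / (2 * n + 1)))"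
  proof (intro sum.cong refl)
    fix m assume "m \<in> {..n}"
    then have "real (2 * n choose (2 * m)) * cos_moment (2 * m) * beta_moment m (n - m) * ((r\<^sup>2) ^ m * ((x $ 3)\<^sup>2) ^ (n - m))
        = real (n choose m) * (4 * pi / (2 * n + 1)) * ((r\<^sup>2) ^ m * ((x $ 3)\<^sup>2) ^ (n - m))"
      by (simp only: binomial_moments atMost_iff of_nat_add of_nat_mult of_nat_numeral of_nat_1)
    then show "real (2 * n choose (2 * m)) * cos_moment (2 * m) * ((r\<^sup>2) ^ m * ((x $ 3)\<^sup>2) ^ (n - m)) * beta_moment m (n - m)
        = real (n choose m) * (r\<^sup>2) ^ m * ((x $ 3)\<^sup>2) ^ (n - m) * (4 * pi / (2 * n + 1))"
      by (simp only: mult_ac)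
  qed
  also have "\<dots> = (r\<^sup>2 + (x $ 3)\<^sup>2) ^ n * (4 * pi / (2 * n + 1))"
    by (simp only: binomial_ring sum_distrib_right)
  finally show ?thesis
    by (simp add: power_mult flip: nx)
qed

text \<open>Termwise integration of the cosine series: the moment contributes 1 / (2 i + 1), which
  raises (2 i)! to (2 i + 1)! and yields the series of sin r / r. Compactness of the chart gives the
  uniform convergence.\<close>

lemma sphere_average_cos:
  "integral sphere_chart (\<lambda>p. cos (sphere_inner x p)) = 4 * pi * sinc (norm x)"
proof -
  define f where "f n p = (- 1) ^ n / fact (2 * n) * sphere_inner x p ^ (2 * n)" for n p
  have "compact (sphere_inner x ` sphere_chart)"
    by (intro compact_continuous_image continuous_intros compact_cbox)
  then have "bounded (sphere_inner x ` sphere_chart)"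
    by (rule compact_imp_bounded)
  then obtain R where R: "\<And>p. p \<in> sphere_chart \<Longrightarrow> \<bar>sphere_inner x p\<bar> \<le> R"
    unfolding bounded_iff by auto
  have f_sums: "(\<lambda>n. f n p) sums cos (sphere_inner x p)" for p
    unfolding f_def by (rule cos_paired)
  have "summable (\<lambda>n. (R\<^sup>2) ^ n / fact n)"
    using summable_exp [of "R\<^sup>2"] by (simp add: divide_inverse mult.commute)
  moreover have "norm (f n p) \<le> (R\<^sup>2) ^ n / fact n" if "p \<in> sphere_chart" for n p
  proof -
    have "norm (f n p) = \<bar>sphere_inner x p\<bar> ^ (2 * n) / fact (2 * n)"
      by (simp add: f_def abs_mult power_abs)
    also have "\<dots> \<le> R ^ (2 * n) / fact n"
      using R [OF that] by (intro frac_le power_mono fact_mono) auto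
    finally show ?thesis by (simp add: power_mult)
  qed
  ultimately have "uniform_limit sphere_chart (\<lambda>n p. \<Sum>i<n. f i p) (\<lambda>p. \<Sum>i. f i p) sequentially"
    by (intro Weierstrass_m_test)
  then have u: "uniform_limit sphere_chart (\<lambda>n p. \<Sum>i<n. f i p) (\<lambda>p. cos (sphere_inner x p)) sequentially"
    using f_sums by (simp add: sums_iff)
  have cf: "continuous_on sphere_chart (f n)" for n
    unfolding f_def [abs_def] by (intro continuous_intros)
  obtain I J where IJ: "\<And>n. ((\<lambda>p. \<Sum>i<n. f i p) has_integral I n) sphere_chart"
     "((\<lambda>p. cos (sphere_inner x p)) has_integral J) sphere_chart" "I \<longlonglongrightarrow> J"
    using uniform_limit_integral_cbox [OF u continuous_on_sum [OF cf] trivial_limit_sequentially] by blast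
  define F where "F i = (- 1) ^ i / fact (2 * i + 1) * norm x ^ (2 * i)" for i
  have If: "integral sphere_chart (f i) = 4 * pi * F i" for i
  proof -
    have "integral sphere_chart (f i) = (- 1) ^ i / fact (2 * i) * (4 * pi * norm x ^ (2 * i) / (2 * i + 1))"
      unfolding f_def [abs_def] by (simp only: integral_mult_right sphere_moment)
    also have "\<dots> = 4 * pi * F i"
      by (simp add: F_def field_simps)
    finally show ?thesis .
  qed
  have "I = (\<lambda>n. \<Sum>i<n. 4 * pi * F i)"
  proof
    fix n
    have "I n = integral sphere_chart (\<lambda>p. \<Sum>i<n. f i p)"
      by (rule integral_unique [OF IJ(1), symmetric])
    also have "\<dots> = (\<Sum>i<n. integral sphere_chart (f i))"
      by (rule integral_sum) (auto intro!: integrable_continuous cf)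
    finally show "I n = (\<Sum>i<n. 4 * pi * F i)" by (simp add: If)
  qed
  with IJ(3) have J: "(\<lambda>i. 4 * pi * F i) sums J"
    by (simp add: sums_def)
  have "F sums sinc (norm x)"
  \<comment> \<open>At 0 only the constant term of the series survives, in agreement with the
    convention sinc 0 = 1.\<close>
  proof (cases "norm x = 0")
    case True
    have "F = (\<lambda>i. if i = 0 then 1 else 0)"
      using True by (auto simp: F_def)
    then show ?thesis using sums_single [of 0 "\<lambda>_. 1::real"] True by simp
  next
    case False
    have "(\<lambda>i. (- 1) ^ i / fact (2 * i + 1) * norm x ^ (2 * i + 1) / norm x) sums (sin (norm x) / norm x)"
      by (intro sums_divide sin_paired)
    then show ?thesis using False by (simp add: F_def [abs_def])
  qed
  then have "J = 4 * pi * sinc (norm x)"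
    using J sums_mult sums_unique2 by blast
  then show ?thesis using IJ(2) by (simp add: integral_unique)
qed

text \<open>For each direction the kernel \<open>cos\<close> is a sum of two rank one kernels whose weights have
  squares summing to \<open>1\<close>, so multiplication by it preserves lower bounds; average over the sphere.\<close>

lemma sinc_mult_form_ge:
  fixes u :: "'i \<Rightarrow> 'e::real_inner" and x :: "'i \<Rightarrow> real ^ 3"
  assumes S: "finite S"
    and K: "\<And>v :: 'i \<Rightarrow> 'e. real_form S K v \<ge> c * (\<Sum>i\<in>S. (norm (v i))\<^sup>2)"
  shows "real_form S (\<lambda>i j. sinc (norm (x i - x j)) * K i j) u \<ge> c * (\<Sum>i\<in>S. (norm (u i))\<^sup>2)"
proof -
  define E where "E = (\<Sum>i\<in>S. (norm (u i))\<^sup>2)"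
  define Q where "Q p = real_form S (\<lambda>i j. cos (sphere_inner (x i - x j) p) * K i j) u" for p
  have Q_ge: "Q p \<ge> c * E" for p
  proof -
    let ?a = "\<lambda>i. sphere_inner (x i) p"
    have "Q p = real_form S (\<lambda>i j. cos (?a i) * cos (?a j) * K i j + sin (?a i) * sin (?a j) * K i j) u"
      unfolding Q_def by (intro real_form_cong) (simp add: sphere_inner_diff cos_diff algebra_simps)
    also have "\<dots> = real_form S K (\<lambda>i. cos (?a i) *\<^sub>R u i) + real_form S K (\<lambda>i. sin (?a i) *\<^sub>R u i)"
      by (simp only: real_form_add real_form_rank_one)
    also have "\<dots> \<ge> c * (\<Sum>i\<in>S. (norm (cos (?a i) *\<^sub>R u i))\<^sup>2) + c * (\<Sum>i\<in>S. (norm (sin (?a i) *\<^sub>R u i))\<^sup>2)"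
      by (intro add_mono K)
    also have "c * (\<Sum>i\<in>S. (norm (cos (?a i) *\<^sub>R u i))\<^sup>2) + c * (\<Sum>i\<in>S. (norm (sin (?a i) *\<^sub>R u i))\<^sup>2)
        = c * (\<Sum>i\<in>S. ((cos (?a i))\<^sup>2 + (sin (?a i))\<^sup>2) * (norm (u i))\<^sup>2)"
      by (simp add: power_mult_distrib sum.distrib algebra_simps del: sin_cos_squared_add2)
    finally show ?thesis by (simp add: E_def)
  qed
  have cQ: "continuous_on sphere_chart Q"
    unfolding Q_def [abs_def] real_form_def by (intro continuous_intros)
  have int: "integral sphere_chart Q = 4 * pi * real_form S (\<lambda>i j. sinc (norm (x i - x j)) * K i j) u"
  proof -
    have *: "(\<lambda>p. cos (sphere_inner y p) * k * l) integrable_on sphere_chart" for y k l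
      by (intro integrable_continuous continuous_intros)
    have "integral sphere_chart Q
        = (\<Sum>i\<in>S. \<Sum>j\<in>S. integral sphere_chart (\<lambda>p. cos (sphere_inner (x i - x j) p) * K i j * (u i \<bullet> u j)))"
      unfolding Q_def [abs_def] real_form_def
      by (subst integral_sum, rule S, intro integrable_sum S *, intro sum.cong refl integral_sum S *)
    also have "\<dots> = (\<Sum>i\<in>S. \<Sum>j\<in>S. 4 * pi * sinc (norm (x i - x j)) * K i j * (u i \<bullet> u j))"
      by (simp only: integral_mult_left sphere_average_cos)
    finally show ?thesis
      by (simp only: real_form_def sum_distrib_left mult_ac)
  qed
  \<comment> \<open>The lower bound holds for every direction; the chart has area 4 pi, the same
    factor as in the average, so it cancels.\<close>
  have "integral sphere_chart (\<lambda>p. c * E) \<le> integral sphere_chart Q"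
    by (intro integral_le integrable_continuous cQ continuous_intros Q_ge)
  then have "4 * pi * (c * E) \<le> 4 * pi * real_form S (\<lambda>i j. sinc (norm (x i - x j)) * K i j) u"
    unfolding int by (simp add: content_Pair mult_ac)
  then show ?thesis by (simp add: E_def)
qed

subsection \<open>Finite sections of a coercive matrix\<close>

text \<open>The matrix is complex symmetric, not Hermitian: \<open>Im (cnj (v i) * v j)\<close>
  changes sign when i and j are exchanged, so its sum against the symmetric real part of
  \<open>A\<close> is zero.\<close>

lemma Im_form_symmetric:
  fixes A :: "'i \<Rightarrow> 'i \<Rightarrow> complex"
  assumes sym: "\<And>i j. A i j = A j i"
  shows "Im (\<Sum>i\<in>S. \<Sum>j\<in>S. cnj (v i) * A i j * v j) = real_form S (\<lambda>i j. Im (A i j)) v"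
proof -
  have eq: "Im (cnj (v i) * A i j * v j) = Im (A i j) * (v i \<bullet> v j) + Re (A i j) * Im (cnj (v i) * v j)" for i j
    by (simp add: inner_complex_def algebra_simps)
  have "(\<Sum>i\<in>S. \<Sum>j\<in>S. Re (A i j) * Im (cnj (v i) * v j))
      = (\<Sum>i\<in>S. \<Sum>j\<in>S. Re (A j i) * Im (cnj (v j) * v i))"
    by (rule sum.swap)
  also have "\<dots> = - (\<Sum>i\<in>S. \<Sum>j\<in>S. Re (A i j) * Im (cnj (v i) * v j))"
    unfolding sum_negf [symmetric] by (intro sum.cong refl) (subst sym, simp add: algebra_simps)
  finally have "(\<Sum>i\<in>S. \<Sum>j\<in>S. Re (A i j) * Im (cnj (v i) * v j)) = 0" by simp
  then show ?thesis
    unfolding Im_sum eq sum.distrib real_form_def by simp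
qed

text \<open>Gaussian elimination: a form that vanishes only at \<open>0\<close> has nonzero diagonal entries, and its
  Schur complement inherits the property.\<close>

lemma finite_system_solvable:
  fixes A :: "'i \<Rightarrow> 'i \<Rightarrow> complex"
  assumes "finite S"
    and "\<And>u. (\<exists>i\<in>S. u i \<noteq> 0) \<Longrightarrow> (\<Sum>i\<in>S. \<Sum>j\<in>S. cnj (u i) * A i j * u j) \<noteq> 0"
  shows "\<exists>u. \<forall>i\<in>S. (\<Sum>j\<in>S. A i j * u j) = b i"
  using assms
proof (induction S arbitrary: A b rule: finite_induct)
  case empty
  then show ?case by simp
next
  case (insert a S)
  have pivot: "A a a \<noteq> 0"
  proof -
    let ?u = "\<lambda>i. if i = a then 1 else 0 :: complex"
    have "(\<Sum>i\<in>insert a S. \<Sum>j\<in>insert a S. cnj (?u i) * A i j * ?u j) = A a a"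
      using insert.hyps by (simp add: if_distrib [of cnj] if_distribR sum.neutral)
    then show ?thesis using insert.prems [of ?u] by auto
  qed
  define A' where "A' i j = A i j - A i a * A a j / A a a" for i j
  \<comment> \<open>The coordinate at the pivot is chosen so that row \<open>a\<close> evaluates to
    \<open>w\<close>. The value 0 tests the Schur complement, \<open>b a\<close> solves the
    system.\<close>
  define ext where "ext v w i = (if i = a then (w - (\<Sum>j\<in>S. A a j * v j)) / A a a else v i)"
    for v :: "'i \<Rightarrow> complex" and w i
  have ext_S: "(\<Sum>j\<in>S. c j * ext v w j) = (\<Sum>j\<in>S. c j * v j)" for c v w
    using insert.hyps by (intro sum.cong refl) (auto simp: ext_def)
  have ext_a: "(\<Sum>j\<in>insert a S. A a j * ext v w j) = w" for v w
    using insert.hyps pivot by (simp add: ext_S) (simp add: ext_def)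
  have ext_row: "(\<Sum>j\<in>insert a S. A i j * ext v w j) = (\<Sum>j\<in>S. A' i j * v j) + A i a * w / A a a" for i v w
  proof -
    have "(\<Sum>j\<in>insert a S. A i j * ext v w j)
        = A i a * ((w - (\<Sum>j\<in>S. A a j * v j)) / A a a) + (\<Sum>j\<in>S. A i j * v j)"
      using insert.hyps by (simp add: ext_S) (simp add: ext_def)
    also have "\<dots> = (\<Sum>j\<in>S. A i j * v j) - (\<Sum>j\<in>S. A i a * A a j / A a a * v j) + A i a * w / A a a"
      using pivot by (simp add: sum_distrib_left sum_divide_distrib field_simps)
    finally show ?thesis
      by (simp add: A'_def sum_subtractf [symmetric] left_diff_distrib)
  qed
  have "\<exists>v. \<forall>i\<in>S. (\<Sum>j\<in>S. A' i j * v j) = b i - A i a * b a / A a a"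
  proof (rule insert.IH)
    fix v :: "'i \<Rightarrow> complex" assume v: "\<exists>i\<in>S. v i \<noteq> 0"
    let ?e = "ext v 0"
    have "\<exists>i\<in>insert a S. ?e i \<noteq> 0" using v insert.hyps by (auto simp: ext_def)
    then have "(\<Sum>i\<in>insert a S. \<Sum>j\<in>insert a S. cnj (?e i) * A i j * ?e j) \<noteq> 0"
      by (rule insert.prems)
    moreover have "(\<Sum>i\<in>insert a S. \<Sum>j\<in>insert a S. cnj (?e i) * A i j * ?e j)
        = (\<Sum>i\<in>insert a S. cnj (?e i) * (\<Sum>j\<in>insert a S. A i j * ?e j))"
      by (simp only: sum_distrib_left mult.assoc)
    moreover have "\<dots> = (\<Sum>i\<in>S. cnj (?e i) * (\<Sum>j\<in>S. A' i j * v j))"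
      using insert.hyps by (subst sum.insert) (simp_all only: ext_a ext_row, auto)
    moreover have "\<dots> = (\<Sum>i\<in>S. \<Sum>j\<in>S. cnj (v i) * A' i j * v j)"
      using insert.hyps by (intro sum.cong refl) (auto simp: ext_def sum_distrib_left mult.assoc)
    ultimately show "(\<Sum>i\<in>S. \<Sum>j\<in>S. cnj (v i) * A' i j * v j) \<noteq> 0" by simp
  qed
  then obtain v where v: "\<And>i. i \<in> S \<Longrightarrow> (\<Sum>j\<in>S. A' i j * v j) = b i - A i a * b a / A a a"
    by blast
  have "\<forall>i\<in>insert a S. (\<Sum>j\<in>insert a S. A i j * ext v (b a) j) = b i"
    using v by (auto simp only: insert_iff ext_a) (simp only: ext_row, simp)
  then show ?case by blast
qed

lemma exp_minus_one_abs: "\<bar>exp x - 1\<bar> \<le> exp \<bar>x\<bar> - (1::real)"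
proof (cases "x \<ge> 0")
  case False
  have "1 - exp x \<le> exp (- x) - 1"
  proof -
    have "0 \<le> (exp (x / 2) - exp (- x / 2))\<^sup>2" by simp
    also have "\<dots> = exp x + exp (- x) - 2"
      by (simp add: power2_eq_square algebra_simps flip: exp_add)
    finally show ?thesis by simp
  qed
  then show ?thesis using False by simp
qed simp

text \<open>Combes--Thomas: conjugating by the weight \<open>exp (\<gamma> * \<rho>)\<close> moves the form by at most half of
  its lower bound.\<close>

lemma finite_system_decay:
  fixes A :: "'i \<Rightarrow> 'i \<Rightarrow> complex" and d :: "'i \<Rightarrow> 'i \<Rightarrow> real"
  assumes S: "finite S" "j \<in> S"
    and coercive: "\<And>v. c * (\<Sum>i\<in>S. (norm (v i))\<^sup>2) \<le> norm (\<Sum>i\<in>S. \<Sum>k\<in>S. cnj (v i) * A i k * v k)"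
    and c: "c > 0"
    and sym: "\<And>i k. A i k = A k i" and d_sym: "\<And>i k. d i k = d k i"
    and triangle: "\<And>i k. \<bar>d i j - d k j\<bar> \<le> d i k" and d_refl: "d j j = 0"
    and \<gamma>: "\<gamma> \<ge> 0"
    and row: "\<And>i. i \<in> S \<Longrightarrow> (\<Sum>k\<in>S. (exp (\<gamma> * d i k) - 1) * norm (A i k)) \<le> c / 2"
    and u: "\<And>i. i \<in> S \<Longrightarrow> (\<Sum>k\<in>S. A i k * u k) = (if i = j then 1 else 0)"
    and i: "i \<in> S"
  shows "norm (u i) \<le> 2 / c * exp (- \<gamma> * d i j)"
proof -
  define w where "w i = complex_of_real (exp (\<gamma> * d i j))" for i
  define v where "v i = w i * u i" for i
  have w0: "w i \<noteq> 0" for i by (simp add: w_def)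
  define E where "E = (\<Sum>i\<in>S. (norm (v i))\<^sup>2)"
  define D where "D i k = (exp (\<gamma> * d i k) - 1) * norm (A i k)" for i k
  have d_nonneg: "d i k \<ge> 0" for i k using triangle [of i k] by linarith
  have weighted: "(\<Sum>k\<in>S. w i / w k * A i k * v k) = (if i = j then 1 else 0)" if "i \<in> S" for i
  proof -
    have "(\<Sum>k\<in>S. w i / w k * A i k * v k) = w i * (\<Sum>k\<in>S. A i k * u k)"
      unfolding sum_distrib_left v_def by (intro sum.cong refl) (simp add: w0)
    then show ?thesis using u [OF that] by (simp add: w_def d_refl)
  qed
  have w_diff: "norm (1 - w i / w k) \<le> exp (\<gamma> * d i k) - 1" for i k
  proof -
    have "w i / w k = of_real (exp (\<gamma> * (d i j - d k j)))"
      by (simp add: w_def exp_diff right_diff_distrib)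
    then have "norm (1 - w i / w k) = \<bar>exp (\<gamma> * (d i j - d k j)) - 1\<bar>"
      by (metis norm_minus_commute norm_of_real of_real_1 of_real_diff)
    also have "\<dots> \<le> exp \<bar>\<gamma> * (d i j - d k j)\<bar> - 1" by (rule exp_minus_one_abs)
    also have "\<dots> \<le> exp (\<gamma> * d i k) - 1"
      using triangle [of i k] \<gamma> by (simp add: abs_mult mult_left_mono)
    finally show ?thesis .
  qed
  have "c * E \<le> norm (\<Sum>i\<in>S. \<Sum>k\<in>S. cnj (v i) * A i k * v k)"
    unfolding E_def by (rule coercive)
  \<comment> \<open>Split \<open>A\<close> into its conjugate by the weight and the defect. The
    conjugate sends \<open>v\<close> to the unit vector at \<open>j\<close>, because the weight is 1
    there, and so contributes only \<open>cnj (v j)\<close>.\<close>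
  also have "(\<Sum>i\<in>S. \<Sum>k\<in>S. cnj (v i) * A i k * v k)
      = (\<Sum>i\<in>S. cnj (v i) * (\<Sum>k\<in>S. w i / w k * A i k * v k))
        + (\<Sum>i\<in>S. \<Sum>k\<in>S. cnj (v i) * ((1 - w i / w k) * A i k) * v k)"
    unfolding sum_distrib_left sum.distrib [symmetric]
    by (intro sum.cong refl) (simp add: algebra_simps)
  also have "(\<Sum>i\<in>S. cnj (v i) * (\<Sum>k\<in>S. w i / w k * A i k * v k)) = cnj (v j)"
  proof -
    have "(\<Sum>i\<in>S. cnj (v i) * (\<Sum>k\<in>S. w i / w k * A i k * v k)) = (\<Sum>i\<in>S. if i = j then cnj (v j) else 0)"
      by (intro sum.cong refl) (simp only: weighted, simp)
    then show ?thesis using S by simp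
  qed
  also have "norm (cnj (v j) + (\<Sum>i\<in>S. \<Sum>k\<in>S. cnj (v i) * ((1 - w i / w k) * A i k) * v k))
      \<le> norm (v j) + (\<Sum>i\<in>S. \<Sum>k\<in>S. D i k * (norm (v i) * norm (v k)))"
  proof (rule norm_triangle_le, rule add_mono)
    have "norm (\<Sum>i\<in>S. \<Sum>k\<in>S. cnj (v i) * ((1 - w i / w k) * A i k) * v k)
        \<le> (\<Sum>i\<in>S. \<Sum>k\<in>S. norm (cnj (v i) * ((1 - w i / w k) * A i k) * v k))"
      by (intro order_trans [OF norm_sum] sum_mono norm_sum)
    also have "\<dots> \<le> (\<Sum>i\<in>S. \<Sum>k\<in>S. D i k * (norm (v i) * norm (v k)))"
    proof (intro sum_mono)
      fix i k
      have "norm (cnj (v i) * ((1 - w i / w k) * A i k) * v k)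
          = norm (1 - w i / w k) * (norm (A i k) * (norm (v i) * norm (v k)))"
        by (simp add: norm_mult mult_ac)
      also have "\<dots> \<le> (exp (\<gamma> * d i k) - 1) * (norm (A i k) * (norm (v i) * norm (v k)))"
        by (intro mult_right_mono w_diff) auto
      finally show "norm (cnj (v i) * ((1 - w i / w k) * A i k) * v k) \<le> D i k * (norm (v i) * norm (v k))"
        by (simp add: D_def mult_ac)
    qed
    finally show "norm (\<Sum>i\<in>S. \<Sum>k\<in>S. cnj (v i) * ((1 - w i / w k) * A i k) * v k)
        \<le> (\<Sum>i\<in>S. \<Sum>k\<in>S. D i k * (norm (v i) * norm (v k)))" .
  qed simp
  also have "(\<Sum>i\<in>S. \<Sum>k\<in>S. D i k * (norm (v i) * norm (v k))) \<le> c / 2 * E"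
    unfolding E_def
    by (rule sum_row_bound) (use \<gamma> d_nonneg row in \<open>auto simp: D_def sym d_sym\<close>)
  finally have bound: "c / 2 * E \<le> norm (v j)" by (simp add: algebra_simps)
  have le_sqrt: "norm (v k) \<le> sqrt E" if "k \<in> S" for k
    unfolding E_def using S that
    by (intro real_le_rsqrt member_le_sum [of k S "\<lambda>k. (norm (v k))\<^sup>2"]) auto
  \<comment> \<open>Since \<open>norm (v j)\<close> is at most \<open>sqrt E\<close>, the bound is
    quadratic on the left and linear on the right in \<open>sqrt E\<close>; one factor cancels
    unless \<open>E = 0\<close>.\<close>
  have "sqrt E \<le> 2 / c"
  proof (cases "E = 0")
    case False
    have E: "E \<ge> 0" by (simp add: E_def sum_nonneg)
    have "c / 2 * (sqrt E * sqrt E) \<le> sqrt E"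
      using bound le_sqrt [OF S(2)] E by simp
    moreover have "sqrt E > 0" using False E by simp
    ultimately have "c / 2 * sqrt E \<le> 1"
      by (metis mult.assoc mult_le_cancel_right1 mult.left_neutral mult_le_cancel_right_pos)
    then show ?thesis using c by (simp add: field_simps)
  qed (use c in simp)
  then have "exp (\<gamma> * d i j) * norm (u i) \<le> 2 / c"
    using le_sqrt [OF i] by (simp add: v_def w_def norm_mult)
  then have "norm (u i) \<le> 2 / c / exp (\<gamma> * d i j)"
    by (subst pos_le_divide_eq) (simp_all add: mult.commute)
  then show ?thesis
    by (simp add: exp_minus divide_inverse)
qed

subsection \<open>Infinite systems\<close>

text \<open>Cantor's diagonal argument over an enumeration of the index type; coordinate n converges
  along the diagonal sequence from position n + 1 on.\<close>

lemma bounded_family_convergent_subsequence: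
  fixes f :: "nat \<Rightarrow> 'i::countable \<Rightarrow> complex"
  assumes "\<And>n i. norm (f n i) \<le> B i"
  obtains r w where "strict_mono r" "\<And>i. (\<lambda>n. f (r n) i) \<longlonglongrightarrow> w i"
proof -
  let ?P = "\<lambda>n s. convergent (\<lambda>k. f (s k) (from_nat n))"
  interpret subseqs ?P
  proof
    fix n :: nat and s :: "nat \<Rightarrow> nat"
    have "bounded (range (\<lambda>k. f (s k) (from_nat n)))"
      unfolding bounded_iff using assms by blast
    then obtain l r' where "strict_mono r'" "((\<lambda>k. f (s k) (from_nat n)) \<circ> r') \<longlonglongrightarrow> l"
      using bounded_imp_convergent_subsequence by blast
    then show "\<exists>r'. strict_mono r' \<and> ?P n (s \<circ> r')"
      by (auto simp: convergent_def comp_def)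
  qed
  have "?P n (diagseq \<circ> (+) (Suc n))" for n
  proof (rule diagseq_holds)
    fix r s :: "nat \<Rightarrow> nat" and n
    assume "strict_mono r" "?P n s"
    then show "?P n (s \<circ> r)"
      using convergent_subseq_convergent [of "\<lambda>k. f (s k) (from_nat n)" r] by (simp add: comp_def)
  qed
  then have "convergent (\<lambda>k. f (diagseq (k + Suc n)) (from_nat n))" for n
    by (simp only: comp_def add.commute)
  then have conv: "convergent (\<lambda>k. f (diagseq k) (from_nat n))" for n
    by (subst (asm) convergent_ignore_initial_segment)
  have "\<exists>l. (\<lambda>k. f (diagseq k) i) \<longlonglongrightarrow> l" for i
    using conv [of "to_nat i"] by (simp add: convergent_def)
  then obtain w where "\<And>i. (\<lambda>k. f (diagseq k) i) \<longlonglongrightarrow> w i" by metis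
  then show ?thesis using that subseq_diagseq by blast
qed

lemma summable_tail_small:
  fixes g :: "'i \<Rightarrow> real"
  assumes "g summable_on UNIV" "\<And>i. g i \<ge> 0" "e > 0"
  obtains F where "finite F" "\<And>G. finite G \<Longrightarrow> G \<inter> F = {} \<Longrightarrow> sum g G \<le> e"
proof -
  obtain F where F: "finite F" "dist (sum g F) (infsum g UNIV) \<le> e"
    using infsum_finite_approximation [OF assms(1,3)] by blast
  show ?thesis
  proof (rule that [OF F(1)])
    fix G assume G: "finite G" "G \<inter> F = {}"
    have "sum g (F \<union> G) \<le> infsum g UNIV"
      using F G assms by (intro finite_sum_le_infsum) auto
    moreover have "sum g (F \<union> G) = sum g F + sum g G"
      using F G by (intro sum.union_disjoint) auto
    ultimately show "sum g G \<le> e" using F(2) by (simp add: dist_real_def)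
  qed
qed

text \<open>A bound independent of the section gives coordinatewise compactness, and the summable
  majorant controls the discarded part of each row uniformly in the section, so each row equation
  survives the limit.\<close>

lemma infinite_system_limit:
  fixes A :: "'i::countable \<Rightarrow> 'i \<Rightarrow> complex"
  assumes S: "\<And>n. finite (S n)" "\<And>i. \<forall>\<^sub>F n in sequentially. i \<in> S n"
    and u: "\<And>n i. i \<in> S n \<Longrightarrow> (\<Sum>k\<in>S n. A i k * u n k) = b i"
    and bound: "\<And>n k. k \<in> S n \<Longrightarrow> norm (u n k) \<le> B k" and B: "\<And>k. B k \<ge> 0"
    and summ: "\<And>i. (\<lambda>k. norm (A i k) * B k) summable_on UNIV"
  obtains w where "\<And>k. norm (w k) \<le> B k" "\<And>i. ((\<lambda>k. A i k * w k) has_sum b i) UNIV"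
proof -
  \<comment> \<open>Extension by 0 places all sections on the common index type and keeps the bound,
    as \<open>B\<close> is nonnegative.\<close>
  define f where "f n k = (if k \<in> S n then u n k else 0)" for n k
  have f_le: "norm (f n k) \<le> B k" for n k
    using bound B by (simp add: f_def)
  obtain r w where r: "strict_mono r" and w: "\<And>i. (\<lambda>n. f (r n) i) \<longlonglongrightarrow> w i"
    using bounded_family_convergent_subsequence f_le by blast
  show ?thesis
  proof (rule that)
    show "norm (w k) \<le> B k" for k
      using tendsto_norm [OF w] by (rule Lim_bounded) (use f_le in auto)
    fix i
    show "((\<lambda>k. A i k * w k) has_sum b i) UNIV"
      unfolding has_sum_def
    proof (rule tendstoI)
      fix e :: real assume e: "e > 0"
      have "norm (A i k) * B k \<ge> 0" for k using B by simp
      moreover have "e / 2 > 0" using e by simp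
      ultimately obtain F0 where F0: "finite F0"
        "\<And>G. finite G \<Longrightarrow> G \<inter> F0 = {} \<Longrightarrow> (\<Sum>k\<in>G. norm (A i k) * B k) \<le> e / 2"
        by (rule summable_tail_small [OF summ]) (rule that)
      \<comment> \<open>For large n the row equation is exact on \<open>S (r n)\<close>. Truncating
        it to \<open>F\<close> loses only indices outside \<open>F0\<close>, hence at most e / 2 for
        every such n, and then in the limit.\<close>
      have near: "norm ((\<Sum>k\<in>F. A i k * w k) - b i) \<le> e / 2" if F: "finite F" "F0 \<subseteq> F" for F
      proof -
        have "\<forall>\<^sub>F n in sequentially. \<forall>k\<in>insert i F. k \<in> S n"
          using F S by (intro eventually_ball_finite) auto
        then have "\<forall>\<^sub>F n in sequentially. \<forall>k\<in>insert i F. k \<in> S (r n)"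
          using eventually_subseq [OF r] by blast
        then have "\<forall>\<^sub>F n in sequentially. norm ((\<Sum>k\<in>F. A i k * f (r n) k) - b i) \<le> e / 2"
        proof eventually_elim
          case (elim n)
          have "b i = (\<Sum>k\<in>S (r n). A i k * f (r n) k)"
            using u [of i "r n"] elim by (simp add: f_def)
          also have "\<dots> = (\<Sum>k\<in>F. A i k * f (r n) k) + (\<Sum>k\<in>S (r n) - F. A i k * f (r n) k)"
            using elim S by (subst sum.subset_diff [of F]) auto
          finally have "norm ((\<Sum>k\<in>F. A i k * f (r n) k) - b i) = norm (\<Sum>k\<in>S (r n) - F. A i k * f (r n) k)"
            by (simp add: norm_minus_commute)
          also have "\<dots> \<le> (\<Sum>k\<in>S (r n) - F. norm (A i k) * B k)"
            by (intro sum_norm_le) (simp add: norm_mult mult_left_mono f_le)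
          also have "\<dots> \<le> e / 2"
            using S F by (intro F0(2)) auto
          finally show ?case .
        qed
        moreover have "(\<lambda>n. norm ((\<Sum>k\<in>F. A i k * f (r n) k) - b i)) \<longlonglongrightarrow> norm ((\<Sum>k\<in>F. A i k * w k) - b i)"
          by (intro tendsto_intros w)
        ultimately show ?thesis
          by (intro tendsto_upperbound) auto
      qed
      show "\<forall>\<^sub>F F in finite_subsets_at_top UNIV. dist (\<Sum>k\<in>F. A i k * w k) (b i) < e"
        unfolding eventually_finite_subsets_at_top
        using F0(1) near e by (intro exI [of _ F0]) (force simp: dist_norm)
    qed
  qed
qed

section \<open>Exponential sums centred at arbitrary points of space\<close>

lemma nearest_lattice_point: "\<exists>m. norm (x - lat m) \<le> 1"
proof
  let ?m = "\<chi> k. round (x $ k)"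
  have "(norm (x - lat ?m))\<^sup>2 = (\<Sum>k\<in>UNIV. (x $ k - of_int (round (x $ k)))\<^sup>2)"
    by (simp add: norm_vec_def L2_set_def lat_def sum_nonneg)
  also have "\<dots> \<le> (\<Sum>k\<in>(UNIV :: 3 set). (1 / 2)\<^sup>2)"
  proof (intro sum_mono)
    fix k
    have "\<bar>x $ k - of_int (round (x $ k))\<bar> \<le> \<bar>1 / 2\<bar>"
      using of_int_round_abs_le [of "x $ k"] by (simp add: abs_minus_commute)
    then show "(x $ k - of_int (round (x $ k)))\<^sup>2 \<le> (1 / 2)\<^sup>2"
      by (simp only: abs_le_square_iff)
  qed
  also have "\<dots> \<le> 1\<^sup>2" by (simp add: power2_eq_square)
  finally show "norm (x - lat ?m) \<le> 1"
    by (rule power2_le_imp_le) simp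
qed

text \<open>Replacing \<open>x\<close> by a lattice point at distance at most 1 costs the factor
  \<open>exp \<gamma>\<close>, uniformly in \<open>x\<close>.\<close>

lemma sum_exp_shift_le:
  assumes "\<gamma> > 0" "finite F"
  shows "(\<Sum>i\<in>F. exp (- \<gamma> * norm (x - lat i))) \<le> exp \<gamma> * lat_sum \<gamma>"
proof -
  obtain m where m: "norm (x - lat m) \<le> 1" using nearest_lattice_point by blast
  have "(\<Sum>i\<in>F. exp (- \<gamma> * norm (x - lat i))) \<le> (\<Sum>i\<in>F. exp \<gamma> * exp (- \<gamma> * norm (lat m - lat i)))"
  proof (rule sum_mono)
    fix i
    have "norm (lat m - lat i) \<le> norm (x - lat i) + norm (x - lat m)"
      using norm_triangle_ineq4 [of "x - lat i" "x - lat m"] by simp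
    then have "norm (lat m - lat i) - 1 \<le> norm (x - lat i)" using m by linarith
    then have "\<gamma> * (norm (lat m - lat i) - 1) \<le> \<gamma> * norm (x - lat i)"
      using assms by (intro mult_left_mono) auto
    then show "exp (- \<gamma> * norm (x - lat i)) \<le> exp \<gamma> * exp (- \<gamma> * norm (lat m - lat i))"
      unfolding exp_add [symmetric] by (simp add: algebra_simps)
  qed
  also have "\<dots> \<le> exp \<gamma> * lat_sum \<gamma>"
    unfolding sum_distrib_left [symmetric] by (intro mult_left_mono sum_exp_lat_le assms) auto
  finally show ?thesis .
qed

lemma summable_exp_shift:
  assumes "\<gamma> > 0"
  shows "(\<lambda>i. exp (- \<gamma> * norm (x - lat i))) summable_on UNIV"
  by (rule nonneg_bdd_above_summable_on)
     (auto intro!: bdd_aboveI2 [where M = "exp \<gamma> * lat_sum \<gamma>"] simp: sum_exp_shift_le [OF assms, simplified])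

lemma sum_exp_pair_le:
  assumes "\<gamma> > 0" "finite F"
  shows "(\<Sum>(i, j)\<in>F. exp (- \<gamma> * norm (x - lat i)) * exp (- \<gamma> * norm (lat i - lat j))) \<le> exp \<gamma> * (lat_sum \<gamma>)\<^sup>2"
proof -
  have "(\<Sum>(i, j)\<in>F. exp (- \<gamma> * norm (x - lat i)) * exp (- \<gamma> * norm (lat i - lat j)))
      \<le> (\<Sum>(i, j)\<in>fst ` F \<times> snd ` F. exp (- \<gamma> * norm (x - lat i)) * exp (- \<gamma> * norm (lat i - lat j)))"
    using assms by (intro sum_mono2 subset_fst_snd) auto
  also have "\<dots> = (\<Sum>i\<in>fst ` F. exp (- \<gamma> * norm (x - lat i)) * (\<Sum>j\<in>snd ` F. exp (- \<gamma> * norm (lat i - lat j))))"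
    by (simp add: sum.cartesian_product [symmetric] sum_distrib_left)
  also have "\<dots> \<le> (\<Sum>i\<in>fst ` F. exp (- \<gamma> * norm (x - lat i)) * lat_sum \<gamma>)"
    using assms by (intro sum_mono mult_left_mono sum_exp_lat_le) auto
  also have "\<dots> \<le> exp \<gamma> * lat_sum \<gamma> * lat_sum \<gamma>"
    unfolding sum_distrib_right [symmetric]
    using assms lat_sum_ge_1 [of \<gamma>] by (intro mult_right_mono sum_exp_shift_le) auto
  finally show ?thesis by (simp add: power2_eq_square mult.assoc)
qed

lemma
  assumes "\<gamma> > 0"
  shows summable_exp_pair:
      "(\<lambda>(i, j). exp (- \<gamma> * norm (x - lat i)) * exp (- \<gamma> * norm (lat i - lat j))) summable_on UNIV" (is ?S)
    and infsum_exp_pair_le: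
      "(\<Sum>\<^sub>\<infinity>(i, j). exp (- \<gamma> * norm (x - lat i)) * exp (- \<gamma> * norm (lat i - lat j))) \<le> exp \<gamma> * (lat_sum \<gamma>)\<^sup>2"
proof -
  show ?S
    by (rule nonneg_bdd_above_summable_on)
       (auto intro!: bdd_aboveI2 [where M = "exp \<gamma> * (lat_sum \<gamma>)\<^sup>2"] sum_exp_pair_le [OF assms, simplified])
  then show "(\<Sum>\<^sub>\<infinity>(i, j). exp (- \<gamma> * norm (x - lat i)) * exp (- \<gamma> * norm (lat i - lat j))) \<le> exp \<gamma> * (lat_sum \<gamma>)\<^sup>2"
    by (rule infsum_le_finite_sums) (use sum_exp_pair_le [OF assms] in auto)
qed

subsection \<open>Decay of the inverse of $\Gamma$\<close>

declare csqrt.simps [simp del]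

lemma csqrt_quadrant:
  assumes "Im z > 0"
  shows "Re (csqrt z) > 0" "Im (csqrt z) > 0"
proof -
  have "2 * Re (csqrt z) * Im (csqrt z) = Im ((csqrt z)\<^sup>2)" by (simp add: power2_eq_square)
  then have prod: "Re (csqrt z) * Im (csqrt z) > 0" using assms by simp
  moreover have "Re (csqrt z) \<ge> 0" by (rule Re_csqrt)
  ultimately show "Re (csqrt z) > 0" "Im (csqrt z) > 0"
    by (auto simp: zero_less_mult_iff)
qed

lemma Gamma_mat_sym: "Gamma_mat z \<omega> i j = Gamma_mat z \<omega> j i"
  by (simp add: Gamma_mat_def G0_def norm_minus_commute)

lemma norm_G0: "cmod (G0 x y z) = exp (- Im (csqrt z) * norm (x - y)) / (4 * pi * norm (x - y))"
  by (simp add: G0_def norm_mult norm_divide)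

text \<open>The sinc kernel is written with lattice points scaled by \<open>Re (csqrt z)\<close> to
  match the averaging lemma. The formula holds on the diagonal too, because
  \<open>1 / \<omega> j\<close> is real and sinc 0 = 1.\<close>

lemma Im_Gamma_mat:
  assumes "Re (csqrt z) > 0"
  shows "Im (Gamma_mat z \<omega> i j) = - (Re (csqrt z) / (4 * pi)) *
    (sinc (norm (Re (csqrt z) *\<^sub>R lat i - Re (csqrt z) *\<^sub>R lat j)) * exp (- Im (csqrt z) * norm (lat i - lat j)))"
proof (cases "i = j")
  case True
  have "\<i> * csqrt z / (4 * of_real pi) = of_real (1 / (4 * pi)) * (\<i> * csqrt z)" by simp
  then show ?thesis
    using True by (simp add: Gamma_mat_def del: of_real_divide)
next
  case False
  define r where "r = norm (lat i - lat j)"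
  have r: "r > 0" using False inj_lat by (simp add: r_def inj_eq)
  have nr: "norm (Re (csqrt z) *\<^sub>R lat i - Re (csqrt z) *\<^sub>R lat j) = Re (csqrt z) * r"
    using assms by (simp add: r_def flip: scaleR_diff_right)
  have "G0 (lat i) (lat j) z = of_real (1 / (4 * pi * r)) * exp (\<i> * csqrt z * of_real r)"
    by (simp add: G0_def r_def)
  then have "Im (G0 (lat i) (lat j) z) = 1 / (4 * pi * r) * (exp (- Im (csqrt z) * r) * sin (Re (csqrt z) * r))"
    by (simp add: Im_exp del: of_real_divide of_real_mult)
  then show ?thesis
    unfolding nr r_def [symmetric] using False r assms by (simp add: Gamma_mat_def mult_ac)
qed

text \<open>The modulus of the form dominates its imaginary part, which is minus a positive form.
  The constant is obtained before \<open>\<omega>\<close> and \<open>S\<close>, so it is uniform in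
  both.\<close>

lemma Gamma_coercive:
  assumes "Im z > 0"
  obtains c where "c > 0"
    "\<And>\<omega> S v. finite S \<Longrightarrow> c * (\<Sum>i\<in>S. (norm (v i))\<^sup>2)
       \<le> norm (\<Sum>i\<in>S. \<Sum>k\<in>S. cnj (v i) * Gamma_mat z \<omega> i k * v k)"
proof -
  let ?k = "csqrt z"
  note k = csqrt_quadrant [OF assms]
  obtain c where c: "c > 0" "\<And>S (u :: int ^ 3 \<Rightarrow> complex). finite S \<Longrightarrow>
       real_form S (\<lambda>i j. exp (- Im ?k * norm (lat i - lat j))) u \<ge> c * (\<Sum>i\<in>S. (norm (u i))\<^sup>2)"
    using lattice_exp_form_ge [OF k(2)] by blast
  show ?thesis
  proof (rule that [of "Re ?k / (4 * pi) * c"])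
    show "Re ?k / (4 * pi) * c > 0" using k c by simp
    fix \<omega> and S :: "(int ^ 3) set" and v :: "int ^ 3 \<Rightarrow> complex"
    assume S: "finite S"
    let ?K = "\<lambda>i j. sinc (norm (Re ?k *\<^sub>R lat i - Re ?k *\<^sub>R lat j)) * exp (- Im ?k * norm (lat i - lat j))"
    let ?F = "\<Sum>i\<in>S. \<Sum>k\<in>S. cnj (v i) * Gamma_mat z \<omega> i k * v k"
    have "Im ?F = real_form S (\<lambda>i j. Im (Gamma_mat z \<omega> i j)) v"
      by (rule Im_form_symmetric) (rule Gamma_mat_sym)
    also have "\<dots> = - (Re ?k / (4 * pi)) * real_form S ?K v"
      unfolding Im_Gamma_mat [OF k(1)] by (rule real_form_cmult)
    finally have Im: "Re ?k / (4 * pi) * real_form S ?K v = - Im ?F" by simp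
    have "c * (\<Sum>i\<in>S. (norm (v i))\<^sup>2) \<le> real_form S ?K v"
      by (rule sinc_mult_form_ge [OF S c(2) [OF S]])
    then have "Re ?k / (4 * pi) * (c * (\<Sum>i\<in>S. (norm (v i))\<^sup>2)) \<le> Re ?k / (4 * pi) * real_form S ?K v"
      using k by (intro mult_left_mono) auto
    also have "\<dots> \<le> norm ?F" unfolding Im using abs_Im_le_cmod [of ?F] by linarith
    finally show "Re ?k / (4 * pi) * c * (\<Sum>i\<in>S. (norm (v i))\<^sup>2) \<le> norm ?F"
      by (simp only: mult.assoc)
  qed
qed

text \<open>The summands \<open>B + cmod (csqrt z)\<close> pay for the diagonal, the 1 for the
  off-diagonal entries, where the distance is at least 1 and so 1 / (4 pi r) <= 1.\<close>

lemma Gamma_mat_bound: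
  assumes "Im z > 0" "\<bar>1 / \<omega> j\<bar> \<le> B"
  shows "cmod (Gamma_mat z \<omega> i j) \<le> (B + cmod (csqrt z) + 1) * exp (- Im (csqrt z) * norm (lat i - lat j))"
proof (cases "i = j")
  case True
  have "cmod (\<i> * csqrt z / (4 * of_real pi)) = cmod (csqrt z) / (4 * pi)"
    by (simp add: norm_mult norm_divide)
  also have "\<dots> \<le> cmod (csqrt z)"
    using pi_ge_two by (simp add: divide_le_eq mult_ge1_I order_trans [OF _ mult_left_mono [of 1 "4 * pi"]])
  finally have "cmod (\<i> * csqrt z / (4 * of_real pi)) \<le> cmod (csqrt z)" .
  moreover have "cmod (of_real (1 / \<omega> j)) \<le> B" using assms by (simp only: norm_of_real)
  ultimately have "cmod (of_real (1 / \<omega> j) - \<i> * csqrt z / (4 * of_real pi)) \<le> B + cmod (csqrt z)"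
    by (intro order_trans [OF norm_triangle_ineq4] add_mono)
  then show ?thesis using True by (simp add: Gamma_mat_def)
next
  case False
  have r: "norm (lat i - lat j) \<ge> 1"
    using norm_lat_ge_1 [of "i - j"] False by (simp add: lat_diff)
  have "1 \<le> 4 * pi * norm (lat i - lat j)"
    using mult_mono [of 1 "4 * pi" 1 "norm (lat i - lat j)"] r pi_ge_two by simp
  then have "cmod (Gamma_mat z \<omega> i j) \<le> exp (- Im (csqrt z) * norm (lat i - lat j)) / 1"
    using False unfolding Gamma_mat_def by (simp only: if_False norm_minus_cancel norm_G0) (intro divide_left_mono, auto)
  also have "\<dots> \<le> (B + cmod (csqrt z) + 1) * exp (- Im (csqrt z) * norm (lat i - lat j))"
  proof -
    have "1 \<le> B + cmod (csqrt z) + 1"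
      using order_trans [OF abs_ge_zero assms(2)] norm_ge_zero [of "csqrt z"] by linarith
    then show ?thesis
      using mult_right_mono [of 1 "B + cmod (csqrt z) + 1" "exp (- Im (csqrt z) * norm (lat i - lat j))"] by simp
  qed
  finally show ?thesis .
qed

text \<open>This makes the Combes-Thomas defect small: exp (\<gamma> r) - 1 <= \<gamma> r exp
  (\<gamma> r). The factor r and the exponential each use a quarter of the decay rate
  \<open>\<kappa>\<close>; half remains for the sum, which is therefore of order
  \<open>\<gamma>\<close>.\<close>

lemma weighted_row_small:
  assumes "c > 0" "\<kappa> > 0" "M > 0"
  obtains \<gamma> where "\<gamma> > 0"
    "\<And>S i. finite S \<Longrightarrow>
      (\<Sum>k\<in>S. (exp (\<gamma> * norm (lat i - lat k)) - 1) * (M * exp (- \<kappa> * norm (lat i - lat k)))) \<le> c"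
proof -
  define L where "L = lat_sum (\<kappa> / 2)"
  have L: "L \<ge> 1" using lat_sum_ge_1 [of "\<kappa> / 2"] assms by (simp add: L_def)
  \<comment> \<open>The first entry lets exp (\<gamma> r) be absorbed, the second is the largest
    value for which the final row bound is at most \<open>c\<close>.\<close>
  define \<gamma> where "\<gamma> = min (\<kappa> / 4) (c * \<kappa> / (4 * M * L))"
  have \<gamma>: "\<gamma> > 0" "\<gamma> \<le> \<kappa> / 4" "\<gamma> * (4 / \<kappa>) * M * L \<le> c"
  proof -
    show "\<gamma> > 0" "\<gamma> \<le> \<kappa> / 4" using assms L by (auto simp: \<gamma>_def)
    have "\<gamma> \<le> c * \<kappa> / (4 * M * L)" by (simp add: \<gamma>_def)
    then have "\<gamma> * (4 * M * L) \<le> c * \<kappa>" using assms L by (simp add: pos_le_divide_eq)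
    then show "\<gamma> * (4 / \<kappa>) * M * L \<le> c" using assms by (simp add: field_simps)
  qed
  have le: "(exp (\<gamma> * r) - 1) * (M * exp (- \<kappa> * r)) \<le> \<gamma> * (4 / \<kappa>) * M * exp (- (\<kappa> / 2) * r)"
    if r: "r \<ge> 0" for r
  proof -
    have "1 - \<gamma> * r \<le> exp (- (\<gamma> * r))" using exp_ge_add_one_self [of "- (\<gamma> * r)"] by simp
    then have "exp (\<gamma> * r) * (1 - \<gamma> * r) \<le> exp (\<gamma> * r) * exp (- (\<gamma> * r))"
      by (intro mult_left_mono) auto
    then have "exp (\<gamma> * r) - 1 \<le> \<gamma> * r * exp (\<gamma> * r)"
      by (simp add: algebra_simps flip: exp_add)
    also have "\<gamma> * r * exp (\<gamma> * r) \<le> \<gamma> * (4 / \<kappa> * exp (\<kappa> / 4 * r)) * exp (\<kappa> / 4 * r)"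
    proof (intro mult_mono)
      have "\<kappa> / 4 * r \<le> exp (\<kappa> / 4 * r)" using exp_ge_add_one_self [of "\<kappa> / 4 * r"] by linarith
      then have "4 / \<kappa> * (\<kappa> / 4 * r) \<le> 4 / \<kappa> * exp (\<kappa> / 4 * r)"
        by (rule mult_left_mono) (use assms in simp)
      moreover have "4 / \<kappa> * (\<kappa> / 4 * r) = r" using assms by simp
      ultimately show "r \<le> 4 / \<kappa> * exp (\<kappa> / 4 * r)" by (simp only:)
      show "exp (\<gamma> * r) \<le> exp (\<kappa> / 4 * r)" using mult_right_mono [OF \<gamma>(2) r] by simp
    qed (use \<gamma> r assms in auto)
    finally have "(exp (\<gamma> * r) - 1) * (M * exp (- \<kappa> * r))
        \<le> \<gamma> * (4 / \<kappa> * exp (\<kappa> / 4 * r)) * exp (\<kappa> / 4 * r) * (M * exp (- \<kappa> * r))"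
      using assms by (intro mult_right_mono) auto
    also have "\<dots> = \<gamma> * (4 / \<kappa>) * M * (exp (\<kappa> / 4 * r) * exp (\<kappa> / 4 * r) * exp (- \<kappa> * r))"
      by (simp only: mult_ac)
    also have "exp (\<kappa> / 4 * r) * exp (\<kappa> / 4 * r) * exp (- \<kappa> * r) = exp (- (\<kappa> / 2) * r)"
      unfolding exp_add [symmetric] by (simp add: field_simps)
    finally show ?thesis .
  qed
  show ?thesis
  proof (rule that [OF \<gamma>(1)])
    fix S :: "(int ^ 3) set" and i :: "int ^ 3" assume S: "finite S"
    have "(\<Sum>k\<in>S. (exp (\<gamma> * norm (lat i - lat k)) - 1) * (M * exp (- \<kappa> * norm (lat i - lat k))))
        \<le> (\<Sum>k\<in>S. \<gamma> * (4 / \<kappa>) * M * exp (- (\<kappa> / 2) * norm (lat i - lat k)))"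
      by (intro sum_mono le) simp
    also have "\<dots> \<le> \<gamma> * (4 / \<kappa>) * M * L"
      unfolding sum_distrib_left [symmetric] L_def
      using assms \<gamma> S by (intro mult_left_mono sum_exp_lat_le) auto
    also have "\<dots> \<le> c" by (rule \<gamma>)
    finally show "(\<Sum>k\<in>S. (exp (\<gamma> * norm (lat i - lat k)) - 1) * (M * exp (- \<kappa> * norm (lat i - lat k)))) \<le> c" .
  qed
qed

text \<open>\<open>c\<close> and \<open>\<gamma>\<close> are fixed before \<open>j\<close> and
  before the section, so the decay survives the limit with constants common to all columns.\<close>

lemma Gamma_solution_decay:
  assumes z: "Im z > 0" and B: "\<And>j. \<bar>1 / \<omega> j\<bar> \<le> B"
  obtains C \<gamma> where "C > 0" "\<gamma> > 0"
    "\<And>j. \<exists>w. (\<forall>i. cmod (w i) \<le> C * exp (- \<gamma> * norm (lat i - lat j))) \<and>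
         (\<forall>i. ((\<lambda>k. Gamma_mat z \<omega> i k * w k) has_sum (if i = j then 1 else 0)) UNIV)"
proof -
  define \<kappa> where "\<kappa> = Im (csqrt z)"
  define M where "M = B + cmod (csqrt z) + 1"
  have \<kappa>: "\<kappa> > 0" using csqrt_quadrant [OF z] by (simp add: \<kappa>_def)
  have M: "M > 0" unfolding M_def using order_trans [OF abs_ge_zero B [of 0]] norm_ge_zero [of "csqrt z"] by linarith
  have bound: "cmod (Gamma_mat z \<omega> i k) \<le> M * exp (- \<kappa> * norm (lat i - lat k))" for i k
    unfolding M_def \<kappa>_def by (rule Gamma_mat_bound [OF z B])
  obtain c where c: "c > 0" "\<And>\<omega> S v. finite S \<Longrightarrow> c * (\<Sum>i\<in>S. (norm (v i))\<^sup>2)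
       \<le> norm (\<Sum>i\<in>S. \<Sum>k\<in>S. cnj (v i) * Gamma_mat z \<omega> i k * v k)"
    using Gamma_coercive [OF z] by blast
  have "c / 2 > 0" using c by simp
  then obtain \<gamma> where \<gamma>: "\<gamma> > 0" "\<And>S i. finite S \<Longrightarrow>
      (\<Sum>k\<in>S. (exp (\<gamma> * norm (lat i - lat k)) - 1) * (M * exp (- \<kappa> * norm (lat i - lat k)))) \<le> c / 2"
    using weighted_row_small [OF _ \<kappa> M] by blast
  define \<beta> where "\<beta> = 2 / c"
  have ex: "\<exists>w. (\<forall>i. cmod (w i) \<le> \<beta> * exp (- \<gamma> * norm (lat i - lat j))) \<and>
         (\<forall>i. ((\<lambda>k. Gamma_mat z \<omega> i k * w k) has_sum (if i = j then 1 else 0)) UNIV)" for j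
  proof -
    \<comment> \<open>Every section contains the source \<open>j\<close>, and the enumeration
      exhausts the lattice.\<close>
    define S where "S n = insert j (from_nat ` {..n})" for n :: nat
    have S: "finite (S n)" "j \<in> S n" for n by (auto simp: S_def)
    have S_exhausts: "\<forall>\<^sub>F n in sequentially. i \<in> S n" for i
      using eventually_ge_at_top [of "to_nat i"]
    proof eventually_elim
      case (elim n)
      then have "i \<in> from_nat ` {..n}" by (intro image_eqI [of _ _ "to_nat i"]) auto
      then show ?case by (simp add: S_def)
    qed
    have "\<exists>u. \<forall>i\<in>S n. (\<Sum>k\<in>S n. Gamma_mat z \<omega> i k * u k) = (if i = j then 1 else 0)" for n
    proof (rule finite_system_solvable [OF S(1)])
      fix u :: "int ^ 3 \<Rightarrow> complex" assume "\<exists>i\<in>S n. u i \<noteq> 0"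
      then have "(\<Sum>i\<in>S n. (norm (u i))\<^sup>2) > 0"
        by (subst less_le) (auto simp: sum_nonneg_eq_0_iff S eq_commute [of 0] intro!: sum_nonneg)
      then have "0 < c * (\<Sum>i\<in>S n. (norm (u i))\<^sup>2)" using c by simp
      also have "\<dots> \<le> norm (\<Sum>i\<in>S n. \<Sum>k\<in>S n. cnj (u i) * Gamma_mat z \<omega> i k * u k)"
        by (rule c(2) [OF S(1)])
      finally show "(\<Sum>i\<in>S n. \<Sum>k\<in>S n. cnj (u i) * Gamma_mat z \<omega> i k * u k) \<noteq> 0" by auto
    qed
    then obtain u where u: "\<And>n i. i \<in> S n \<Longrightarrow> (\<Sum>k\<in>S n. Gamma_mat z \<omega> i k * u n k) = (if i = j then 1 else 0)"
      by metis
    have u_le: "cmod (u n i) \<le> \<beta> * exp (- \<gamma> * norm (lat i - lat j))" if i: "i \<in> S n" for n i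
      unfolding \<beta>_def
    proof (rule finite_system_decay [where A = "Gamma_mat z \<omega>" and d = "\<lambda>i k. norm (lat i - lat k)" and S = "S n"])
      fix i k
      show "\<bar>norm (lat i - lat j) - norm (lat k - lat j)\<bar> \<le> norm (lat i - lat k)"
        using norm_triangle_ineq3 [of "lat i - lat j" "lat k - lat j"] by simp
    next
      fix i
      have "(\<Sum>k\<in>S n. (exp (\<gamma> * norm (lat i - lat k)) - 1) * cmod (Gamma_mat z \<omega> i k))
        \<le> (\<Sum>k\<in>S n. (exp (\<gamma> * norm (lat i - lat k)) - 1) * (M * exp (- \<kappa> * norm (lat i - lat k))))"
        using \<gamma>(1) by (intro sum_mono mult_left_mono bound) auto
      also have "\<dots> \<le> c / 2" by (rule \<gamma>(2) [OF S(1)])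
      finally show "(\<Sum>k\<in>S n. (exp (\<gamma> * norm (lat i - lat k)) - 1) * cmod (Gamma_mat z \<omega> i k)) \<le> c / 2" .
    qed (use S c \<gamma> u i Gamma_mat_sym in \<open>auto simp: norm_minus_commute\<close>)
    have summ: "(\<lambda>k. cmod (Gamma_mat z \<omega> i k) * (\<beta> * exp (- \<gamma> * norm (lat k - lat j)))) summable_on UNIV" for i
    proof (rule summable_on_comparison_test)
      show "(\<lambda>k. M * \<beta> * exp (- \<kappa> * norm (lat i - lat k))) summable_on UNIV"
        by (intro summable_on_cmult_right summable_exp_shift \<kappa>)
      fix k
      have "exp (- \<gamma> * norm (lat k - lat j)) \<le> 1" using \<gamma> by simp
      then have "cmod (Gamma_mat z \<omega> i k) * (\<beta> * exp (- \<gamma> * norm (lat k - lat j)))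
          \<le> M * exp (- \<kappa> * norm (lat i - lat k)) * (\<beta> * 1)"
        using M c by (intro mult_mono bound mult_left_mono) (auto simp: \<beta>_def)
      then show "cmod (Gamma_mat z \<omega> i k) * (\<beta> * exp (- \<gamma> * norm (lat k - lat j)))
          \<le> M * \<beta> * exp (- \<kappa> * norm (lat i - lat k))" by (simp add: mult_ac)
    qed (use c in \<open>auto simp: \<beta>_def\<close>)
    obtain w where "\<And>k. cmod (w k) \<le> \<beta> * exp (- \<gamma> * norm (lat k - lat j))"
      "\<And>i. ((\<lambda>k. Gamma_mat z \<omega> i k * w k) has_sum (if i = j then 1 else 0)) UNIV"
      by (rule infinite_system_limit [where A = "Gamma_mat z \<omega>" and S = S and u = u and b = "\<lambda>i. if i = j then 1 else 0"
            and B = "\<lambda>k. \<beta> * exp (- \<gamma> * norm (lat k - lat j))"])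
        (use S S_exhausts u u_le summ c that in \<open>auto simp: \<beta>_def\<close>)
    then show ?thesis by blast
  qed
  show ?thesis
    by (rule that [of \<beta> \<gamma>]) (use c \<gamma> ex in \<open>auto simp: \<beta>_def\<close>)
qed

lemma ell2_bounded:
  assumes "u \<in> ell2"
  obtains U where "U \<ge> 0" "\<And>i. cmod (u i) \<le> U"
proof
  let ?I = "\<Sum>\<^sub>\<infinity>i. (cmod (u i))\<^sup>2"
  show "sqrt ?I \<ge> 0" by (simp add: infsum_nonneg)
  show "cmod (u i) \<le> sqrt ?I" for i
    using assms finite_sum_le_infsum [of "\<lambda>i. (cmod (u i))\<^sup>2" UNIV "{i}"]
    by (intro real_le_rsqrt) (simp add: ell2_def)
qed

text \<open>By symmetry of the matrix, pairing \<open>\<Gamma> u\<close> with the solution \<open>w\<close> of \<open>\<Gamma> w = e\<^sub>j\<close> recovers \<open>u j\<close>;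
  hence \<open>\<Gamma>\<close> is injective on \<open>\<ell>\<^sup>2\<close>.\<close>

lemma Gamma_op_pairing:
  assumes z: "Im z > 0" and B: "\<And>j. \<bar>1 / \<omega> j\<bar> \<le> B" and u: "u \<in> ell2"
    and w: "\<And>i. cmod (w i) \<le> C * exp (- \<gamma> * norm (lat i - lat j))" and \<gamma>: "\<gamma> > 0"
    and sol: "\<And>i. ((\<lambda>k. Gamma_mat z \<omega> i k * w k) has_sum (if i = j then 1 else 0)) UNIV"
  shows "(\<Sum>\<^sub>\<infinity>i. w i * Gamma_op z \<omega> u i) = u j"
proof -
  define \<kappa> where "\<kappa> = Im (csqrt z)"
  define M where "M = B + cmod (csqrt z) + 1"
  have \<kappa>: "\<kappa> > 0" using csqrt_quadrant [OF z] by (simp add: \<kappa>_def)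
  have M: "M > 0" unfolding M_def using order_trans [OF abs_ge_zero B [of 0]] norm_ge_zero [of "csqrt z"] by linarith
  have bound: "cmod (Gamma_mat z \<omega> i k) \<le> M * exp (- \<kappa> * norm (lat i - lat k))" for i k
    unfolding M_def \<kappa>_def by (rule Gamma_mat_bound [OF z B])
  have C: "C \<ge> 0" using order_trans [OF norm_ge_zero w [of j]] by simp
  obtain U where U: "U \<ge> 0" "\<And>i. cmod (u i) \<le> U" using ell2_bounded [OF u] by blast
  define \<delta> where "\<delta> = min \<gamma> \<kappa>"
  have \<delta>: "\<delta> > 0" "\<delta> \<le> \<gamma>" "\<delta> \<le> \<kappa>" using \<kappa> \<gamma> by (auto simp: \<delta>_def)
  \<comment> \<open>Absolute summability justifies exchanging the two sums. The decay comes from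
    \<open>w\<close> in i - j and from the matrix in i - k; of \<open>u\<close> only boundedness
    enters.\<close>
  have summ: "(\<lambda>(i, k). w i * (Gamma_mat z \<omega> i k * u k)) summable_on UNIV \<times> UNIV"
  proof (rule abs_summable_summable, rule summable_on_comparison_test)
    show "(\<lambda>(i, k). (C * M * U) * (exp (- \<delta> * norm (lat j - lat i)) * exp (- \<delta> * norm (lat i - lat k)))) summable_on UNIV \<times> UNIV"
      using summable_on_cmult_right [OF summable_exp_pair [OF \<delta>(1), of "lat j"], of "C * M * U"]
      by (simp add: case_prod_unfold)
    fix p :: "(int ^ 3) \<times> (int ^ 3)"
    obtain i k where p: "p = (i, k)" by (cases p)
    have "cmod (w i) \<le> C * exp (- \<delta> * norm (lat j - lat i))"
      using w [of i] \<delta> C by (elim order_trans) (intro mult_left_mono, auto simp: norm_minus_commute mult_right_mono)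
    moreover have "cmod (Gamma_mat z \<omega> i k) \<le> M * exp (- \<delta> * norm (lat i - lat k))"
      using bound [of i k] \<delta> M
      by (elim order_trans) (intro mult_left_mono, auto simp: mult_right_mono)
    ultimately have "cmod (w i) * (cmod (Gamma_mat z \<omega> i k) * cmod (u k))
        \<le> C * exp (- \<delta> * norm (lat j - lat i)) * (M * exp (- \<delta> * norm (lat i - lat k)) * U)"
      using C M U by (intro mult_mono) auto
    then show "norm (case p of (i, k) \<Rightarrow> w i * (Gamma_mat z \<omega> i k * u k))
        \<le> (case p of (i, k) \<Rightarrow> (C * M * U) * (exp (- \<delta> * norm (lat j - lat i)) * exp (- \<delta> * norm (lat i - lat k))))"
      by (simp add: p norm_mult mult_ac)
  qed auto
  have "(\<Sum>\<^sub>\<infinity>i. w i * Gamma_op z \<omega> u i) = (\<Sum>\<^sub>\<infinity>i. \<Sum>\<^sub>\<infinity>k. w i * (Gamma_mat z \<omega> i k * u k))"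
    by (simp add: Gamma_op_def infsum_cmult_right')
  also have "\<dots> = (\<Sum>\<^sub>\<infinity>k. \<Sum>\<^sub>\<infinity>i. w i * (Gamma_mat z \<omega> i k * u k))"
    using summ by (intro infsum_swap_banach)
  also have "\<dots> = (\<Sum>\<^sub>\<infinity>k. u k * (\<Sum>\<^sub>\<infinity>i. Gamma_mat z \<omega> k i * w i))"
  proof (intro infsum_cong)
    fix k
    have eq: "w i * (Gamma_mat z \<omega> i k * u k) = u k * (Gamma_mat z \<omega> k i * w i)" for i
      by (subst Gamma_mat_sym) (simp add: mult_ac)
    show "(\<Sum>\<^sub>\<infinity>i. w i * (Gamma_mat z \<omega> i k * u k)) = u k * (\<Sum>\<^sub>\<infinity>i. Gamma_mat z \<omega> k i * w i)"
      unfolding eq by (rule infsum_cmult_right')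
  qed
  also have "\<dots> = (\<Sum>\<^sub>\<infinity>k. u k * (if k = j then 1 else 0))"
    using infsumI [OF sol] by simp
  also have "\<dots> = (\<Sum>\<^sub>\<infinity>k\<in>{j}. u k)"
    by (rule infsum_cong_neutral) auto
  finally show ?thesis by simp
qed

text \<open>\<open>inv_into\<close> selects some preimage in \<open>ell2\<close>. The decaying
  solution \<open>w j\<close> is one, and injectivity makes it the selected one.\<close>

lemma Gamma_inv_mat_decay:
  assumes z: "Im z > 0" and B: "\<And>j. \<bar>1 / \<omega> j\<bar> \<le> B"
  obtains C \<gamma> where "C > 0" "\<gamma> > 0"
    "\<And>i j. cmod (Gamma_inv_mat z \<omega> i j) \<le> C * exp (- \<gamma> * norm (lat i - lat j))"
proof -
  obtain C \<gamma> where C: "C > 0" "\<gamma> > 0" and ex: "\<And>j. \<exists>w. (\<forall>i. cmod (w i) \<le> C * exp (- \<gamma> * norm (lat i - lat j))) \<and>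
         (\<forall>i. ((\<lambda>k. Gamma_mat z \<omega> i k * w k) has_sum (if i = j then 1 else 0)) UNIV)"
    by (rule Gamma_solution_decay [where \<omega> = \<omega>, OF z B]) (rule that)
  obtain w where w: "\<And>i j. cmod (w j i) \<le> C * exp (- \<gamma> * norm (lat i - lat j))"
      "\<And>i j. ((\<lambda>k. Gamma_mat z \<omega> i k * w j k) has_sum (if i = j then 1 else 0)) UNIV"
    using ex by metis
  have inj: "inj_on (Gamma_op z \<omega>) ell2"
  proof (intro inj_onI ext)
    fix u v j assume uv: "u \<in> ell2" "v \<in> ell2" and eq: "Gamma_op z \<omega> u = Gamma_op z \<omega> v"
    have "u j = (\<Sum>\<^sub>\<infinity>i. w j i * Gamma_op z \<omega> u i)"
      by (rule Gamma_op_pairing [OF z B uv(1) w(1) C(2) w(2), symmetric])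
    also have "\<dots> = v j"
      unfolding eq by (rule Gamma_op_pairing [OF z B uv(2) w(1) C(2) w(2)])
    finally show "u j = v j" .
  qed
  have ell2: "w j \<in> ell2" for j
    unfolding ell2_def mem_Collect_eq
  proof (rule summable_on_comparison_test)
    show "(\<lambda>i. C\<^sup>2 * exp (- (2 * \<gamma>) * norm (lat j - lat i))) summable_on UNIV"
      using C by (intro summable_on_cmult_right summable_exp_shift) auto
    fix i
    have "(cmod (w j i))\<^sup>2 \<le> (C * exp (- \<gamma> * norm (lat i - lat j)))\<^sup>2"
      by (intro power_mono w) auto
    also have "\<dots> = C\<^sup>2 * exp (- (2 * \<gamma>) * norm (lat j - lat i))"
      by (simp add: power_mult_distrib norm_minus_commute flip: exp_of_nat_mult)
    finally show "(cmod (w j i))\<^sup>2 \<le> C\<^sup>2 * exp (- (2 * \<gamma>) * norm (lat j - lat i))" .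
  qed auto
  have "Gamma_op z \<omega> (w j) = (\<lambda>k. if k = j then 1 else 0)" for j
    using infsumI [OF w(2)] by (auto simp: Gamma_op_def)
  then have "Gamma_inv_mat z \<omega> i j = w j i" for i j
    unfolding Gamma_inv_mat_def using inv_into_f_eq [OF inj ell2] by simp
  then show ?thesis using that [OF C] w(1) by simp
qed

subsection \<open>Bounds for the Green function\<close>

text \<open>Dyadic domination: balls of radius 2^(-k) with weights 2^(k+1) lie above 1 / |v|, and
  their volumes of order 8^(-k) leave a geometric series of ratio 1/4.\<close>

lemma nn_integral_inverse_norm_finite:
  "(\<integral>\<^sup>+v\<in>cball (0 :: real ^ 3) 1. ennreal (1 / norm v) \<partial>lborel) < \<infinity>"
proof -
  let ?g = "\<lambda>k (v :: real ^ 3). ennreal (2 ^ Suc k) * indicator (cball 0 ((1 / 2) ^ k)) v"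
  have [measurable]: "cball (c :: real ^ 3) r \<in> sets borel" for c r
    by simp
  define V where "V = unit_ball_vol 3"
  have V: "V \<ge> 0" by (simp add: V_def)
  have le: "ennreal (1 / norm v) * indicator (cball 0 1) v \<le> (\<Sum>k. ?g k v)" for v :: "real ^ 3"
  \<comment> \<open>The origin is trivial because 1 / 0 = 0; outside the unit ball the indicator
    vanishes.\<close>
  proof (cases "v = 0 \<or> norm v > 1")
    case True
    then show ?thesis by auto
  next
    case False
    then have v: "norm v > 0" "norm v \<le> 1" by auto
    obtain n0 where n0: "(1 / 2) ^ n0 < norm v"
      using real_arch_pow_inv [OF v(1), of "1 / 2"] by auto
    \<comment> \<open>Minimality puts \<open>v\<close> in the shell 2^(-(k+1)) < |v| <= 2^(-k) with
      \<open>n = Suc k\<close>.\<close>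
    define n where "n = (LEAST n. (1 / 2) ^ n < norm v)"
    have n: "(1 / 2) ^ n < norm v" 
      unfolding n_def using LeastI [of "\<lambda>n. (1 / 2) ^ n < norm v", OF n0] by simp
    have "n \<noteq> 0" using n v by (cases n) auto
    then obtain k where k: "n = Suc k" by (cases n) auto
    have "norm v \<le> (1 / 2) ^ k"
      using not_less_Least [of k "\<lambda>n. (1 / 2) ^ n < norm v"] k by (simp add: n_def)
    moreover have "1 / norm v \<le> 2 ^ Suc k"
    proof -
      have "1 / norm v \<le> 1 / (1 / 2) ^ Suc k"
        using n v unfolding k by (intro divide_left_mono) auto
      then show ?thesis by (simp add: power_one_over)
    qed
    ultimately have "ennreal (1 / norm v) * indicator (cball 0 1) v \<le> ?g k v"
      using v by (simp add: ennreal_leI)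
    also have "\<dots> \<le> (\<Sum>k. ?g k v)"
    proof -
      have "h k \<le> suminf h" for h :: "nat \<Rightarrow> ennreal"
        using sum_le_suminf [of h "{k}"] by simp
      then show ?thesis .
    qed
    finally show ?thesis .
  qed
  have "(\<integral>\<^sup>+v\<in>cball (0 :: real ^ 3) 1. ennreal (1 / norm v) \<partial>lborel) \<le> (\<integral>\<^sup>+v. (\<Sum>k. ?g k v) \<partial>lborel)"
    by (intro nn_integral_mono le)
  also have "\<dots> = (\<Sum>k. \<integral>\<^sup>+v. ?g k v \<partial>lborel)"
    by (intro nn_integral_suminf) measurable
  also have "\<dots> = (\<Sum>k. ennreal (2 * V * (1 / 4) ^ k))"
  proof (intro suminf_cong)
    fix k
    have "(\<integral>\<^sup>+v. ?g k v \<partial>lborel) = ennreal (2 ^ Suc k) * emeasure lborel (cball (0 :: real ^ 3) ((1 / 2) ^ k))"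
      by (rule nn_integral_cmult_indicator) simp
    also have "\<dots> = ennreal (2 ^ Suc k * (V * ((1 / 2) ^ k) ^ 3))"
      by (subst emeasure_cball) (simp_all add: V_def ennreal_mult)
    also have "2 ^ Suc k * (V * ((1 / 2) ^ k) ^ 3) = 2 * V * (2 * (1 / 2) ^ 3) ^ k"
      by (simp only: power_Suc power_mult_distrib power_mult [symmetric] mult_ac)
    finally show "(\<integral>\<^sup>+v. ?g k v \<partial>lborel) = ennreal (2 * V * (1 / 4) ^ k)"
      by (simp add: power3_eq_cube)
  qed
  also have "\<dots> = ennreal (\<Sum>k. 2 * V * (1 / 4) ^ k)"
    using V by (intro suminf_ennreal2 summable_mult summable_geometric) auto
  also have "\<dots> < \<infinity>" by simp
  finally show ?thesis .
qed

lemma unit_cube_measurable [measurable]: "unit_cube \<in> sets borel"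
  by (simp add: unit_cube_def)

text \<open>Uniformity in \<open>a\<close>: where \<open>norm (a - y)\<close> exceeds 1 the
  integrand is at most 1 and costs the volume of the cube; the rest is the unit ball integral after
  a reflection and translation.\<close>

lemma unit_cube_integral_bounds:
  obtains K V where "K \<ge> 0" "V \<ge> 0" "emeasure lborel unit_cube = ennreal V"
    "\<And>a. (\<integral>\<^sup>+y\<in>unit_cube. ennreal (1 / norm (a - y)) \<partial>lborel) \<le> ennreal K"
proof -
  have [measurable]: "cball (c :: real ^ 3) r \<in> sets borel" for c r
    by simp
  define V where "V = measure lborel unit_cube"
  have "emeasure lborel unit_cube \<noteq> \<top>"
    unfolding unit_cube_def by (rule less_imp_neq [OF emeasure_lborel_cbox_finite, unfolded infinity_ennreal_def])
  then have V: "emeasure lborel unit_cube = ennreal V" "V \<ge> 0"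
    by (simp_all add: V_def emeasure_eq_ennreal_measure)
  define J where "J = enn2real (\<integral>\<^sup>+v\<in>cball (0 :: real ^ 3) 1. ennreal (1 / norm v) \<partial>lborel)"
  have J: "J \<ge> 0" "(\<integral>\<^sup>+v\<in>cball (0 :: real ^ 3) 1. ennreal (1 / norm v) \<partial>lborel) = ennreal J"
    unfolding J_def using nn_integral_inverse_norm_finite by (simp_all add: infinity_ennreal_def)
  have "(\<integral>\<^sup>+y\<in>unit_cube. ennreal (1 / norm (a - y)) \<partial>lborel) \<le> ennreal (V + J)" for a
  proof -
    have "(\<integral>\<^sup>+y\<in>unit_cube. ennreal (1 / norm (a - y)) \<partial>lborel)
        \<le> (\<integral>\<^sup>+y. indicator unit_cube y + ennreal (1 / norm (a - y)) * indicator (cball 0 1) (a - y) \<partial>lborel)"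
    proof (rule nn_integral_mono)
      fix y
      show "ennreal (1 / norm (a - y)) * indicator unit_cube y
        \<le> indicator unit_cube y + ennreal (1 / norm (a - y)) * indicator (cball 0 1) (a - y)"
      proof (cases "norm (a - y) \<le> 1")
        case False
        then have "ennreal (1 / norm (a - y)) \<le> ennreal 1"
          by (intro ennreal_leI) (simp add: divide_le_eq)
        then show ?thesis using False by (auto simp: indicator_def)
      qed (auto simp: indicator_def)
    qed
    also have "\<dots> = emeasure lborel unit_cube
        + (\<integral>\<^sup>+y. ennreal (1 / norm (a - y)) * indicator (cball 0 1) (a - y) \<partial>lborel)"
      by (subst nn_integral_add) auto
    also have "(\<integral>\<^sup>+y. ennreal (1 / norm (a - y)) * indicator (cball 0 1) (a - y) \<partial>lborel)
        = (\<integral>\<^sup>+y. ennreal (1 / norm y) * indicator (cball 0 1) y \<partial>distr lborel borel (\<lambda>y. a - y))"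
      by (subst nn_integral_distr) auto
    also have "distr lborel borel (\<lambda>y. a - y) = lborel"
      using lborel_affine [of "- 1" a] by (simp add: density_1)
    finally show ?thesis using V J by simp
  qed
  then show ?thesis using that [of "V + J" V] V J by simp
qed

section \<open>The unit cube and the distance to the lattice\<close>

lemma unit_cube_component:
  assumes "x \<in> unit_cube"
  shows "\<bar>x $ k\<bar> \<le> 1 / 2"
proof -
  have "- 1 / 2 \<le> x $ k" "x $ k \<le> 1 / 2"
    using assms by (auto simp: unit_cube_def mem_box_cart)
  then show ?thesis by linarith
qed

text \<open>Coordinates have modulus at most 1/2, so a nonzero integer shift cannot shorten them. On
  the cube the norm thus serves as the lattice distance, with a singularity at the origin
  only.\<close>

lemma norm_le_dist_lattice:
  assumes "x \<in> unit_cube"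
  shows "norm x \<le> norm (x - lat i)"
proof (rule norm_le_componentwise_cart)
  fix k
  have "\<bar>x $ k\<bar> \<le> \<bar>x $ k - of_int (i $ k)\<bar>"
  proof (cases "i $ k = 0")
    case False
    then have "\<bar>real_of_int (i $ k)\<bar> \<ge> 1" by (simp flip: of_int_abs)
    then show ?thesis using unit_cube_component [OF assms, of k] by linarith
  qed simp
  then show "norm (x $ k) \<le> norm ((x - lat i) $ k)" by (simp add: lat_def)
qed

lemma norm_unit_cube_le: "x \<in> unit_cube \<Longrightarrow> norm x \<le> 1"
  using nearest_lattice_point [of x] norm_le_dist_lattice order_trans by blast

lemma closed_lattice: "closed lattice"
proof (rule discrete_imp_closed [of 1])
  show "\<forall>x\<in>lattice. \<forall>y\<in>lattice. dist y x < 1 \<longrightarrow> y = x"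
  proof clarify
    fix m n assume "dist (lat n) (lat m) < 1"
    then show "lat n = lat m"
      using norm_lat_ge_1 [of "n - m"] by (cases "n = m") (auto simp: dist_norm lat_diff)
  qed
qed simp

lemma infdist_lattice:
  shows "infdist x lattice \<le> norm (x - lat i)" "infdist x lattice \<le> 1"
    "x \<notin> lattice \<Longrightarrow> infdist x lattice > 0"
proof -
  show le: "infdist x lattice \<le> norm (x - lat i)" for i
    using infdist_le [of "lat i" lattice x] by (simp add: dist_norm)
  show "infdist x lattice \<le> 1"
    using nearest_lattice_point [of x] le order_trans by blast
  show "x \<notin> lattice \<Longrightarrow> infdist x lattice > 0"
    using infdist_pos_not_in_closed [OF closed_lattice] by blast
qed

lemma norm_G0_le:
  assumes "r > 0" "r \<le> norm (x - y)"
  shows "cmod (G0 x y z) \<le> exp (- Im (csqrt z) * norm (x - y)) / r"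
proof -
  have "1 * r \<le> 4 * pi * norm (x - y)"
    using assms pi_ge_two by (intro mult_mono) auto
  then show ?thesis
    unfolding norm_G0 using assms by (intro divide_left_mono) auto
qed

text \<open>The distances to the lattice enter through arbitrary lower bounds \<open>s\<close> and
  \<open>t\<close>: the pointwise estimate takes \<open>infdist\<close>, the integral over cubes
  takes the norm within the cube.\<close>

lemma Green_formula_bound:
  assumes z: "Im z > 0" and B: "\<And>j. \<bar>1 / \<omega> j\<bar> \<le> B"
  shows "\<exists>D \<delta>. D > 0 \<and> \<delta> > 0 \<and> (\<forall>x y s t. s > 0 \<longrightarrow> t > 0 \<longrightarrow> x \<noteq> y \<longrightarrow>
      (\<forall>i. s \<le> norm (x - lat i)) \<longrightarrow> (\<forall>i. t \<le> norm (y - lat i)) \<longrightarrow>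
      cmod (Green_formula \<omega> x y z) \<le> exp (- \<delta> * norm (x - y)) * (1 / norm (x - y) + D / (s * t)))"
proof -
  define \<kappa> where "\<kappa> = Im (csqrt z)"
  have \<kappa>: "\<kappa> > 0" using csqrt_quadrant [OF z] by (simp add: \<kappa>_def)
  obtain C \<gamma> where C: "C > 0" "\<gamma> > 0"
    "\<And>i j. cmod (Gamma_inv_mat z \<omega> i j) \<le> C * exp (- \<gamma> * norm (lat i - lat j))"
    by (rule Gamma_inv_mat_decay [where \<omega> = \<omega>, OF z B]) (rule that)
  \<comment> \<open>Half of the common rate becomes decay in |x - y|, the other half makes the
    double sum converge.\<close>
  define \<delta> where "\<delta> = min \<kappa> \<gamma> / 2"
  have \<delta>: "\<delta> > 0" "2 * \<delta> \<le> \<kappa>" "2 * \<delta> \<le> \<gamma>" using \<kappa> C by (auto simp: \<delta>_def)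
  define D where "D = C * (exp \<delta> * (lat_sum \<delta>)\<^sup>2)"
  have D: "D > 0" using C lat_sum_ge_1 [OF \<delta>(1)] by (simp add: D_def)
  show ?thesis
  proof (intro exI conjI allI impI, rule D, rule \<delta>(1))
    fix x y :: "real ^ 3" and s t :: real
    assume st: "s > 0" "t > 0" and xy: "x \<noteq> y"
      and st_le: "\<forall>i. s \<le> norm (x - lat i)" "\<forall>i. t \<le> norm (y - lat i)"
    then have s: "\<And>i. s \<le> norm (x - lat i)" and t: "\<And>i. t \<le> norm (y - lat i)" by auto
    define F where "F = (\<lambda>(i, j). G0 x (lat i) z * Gamma_inv_mat z \<omega> i j * G0 (lat j) y z)"
    define P where "P = C / (s * t) * exp (- \<delta> * norm (x - y))"
    define E where "E = (\<lambda>(i, j). exp (- \<delta> * norm (x - lat i)) * exp (- \<delta> * norm (lat i - lat j)))"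
    have P: "P \<ge> 0" using C st by (simp add: P_def)
    have term_le: "norm (F p) \<le> P * E p" for p
    proof -
      obtain i j where p: "p = (i, j)" by (cases p)
      let ?a = "norm (x - lat i)" and ?b = "norm (lat i - lat j)" and ?c = "norm (y - lat j)"
      have tri: "norm (x - y) \<le> ?a + ?b + ?c"
        using norm_triangle_ineq [of "x - lat i" "lat i - lat j"] norm_triangle_ineq4 [of "x - lat j" "y - lat j"]
        by simp
      have "norm (F p) = cmod (G0 x (lat i) z) * cmod (Gamma_inv_mat z \<omega> i j) * cmod (G0 y (lat j) z)"
        by (simp add: F_def p norm_mult norm_G0 norm_minus_commute)
      also have "\<dots> \<le> (exp (- \<kappa> * ?a) / s) * (C * exp (- \<gamma> * ?b)) * (exp (- \<kappa> * ?c) / t)"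
        unfolding \<kappa>_def using st s t C by (intro mult_mono norm_G0_le) auto
      also have "\<dots> = C / (s * t) * exp (- \<kappa> * ?a + - \<gamma> * ?b + - \<kappa> * ?c)"
        by (simp only: exp_add) simp
      \<comment> \<open>One share of \<open>\<delta>\<close> on the path x, i, j, y gives exp (-
        \<delta> |x - y|) by the triangle inequality. Of the other share, the legs x-i and i-j are
        kept for summation and the leg j-y is estimated by 1.\<close>
      also have "\<dots> \<le> C / (s * t) * exp (- \<delta> * norm (x - y) + (- \<delta> * ?a + - \<delta> * ?b))"
      proof -
        have "2 * \<delta> * ?a \<le> \<kappa> * ?a" "2 * \<delta> * ?b \<le> \<gamma> * ?b" "2 * \<delta> * ?c \<le> \<kappa> * ?c"
          using \<delta> by (intro mult_right_mono; simp)+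
        moreover have "\<delta> * norm (x - y) \<le> \<delta> * (?a + ?b + ?c)" "0 \<le> \<delta> * ?c"
          using \<delta> tri by (auto intro!: mult_left_mono)
        ultimately have "- \<kappa> * ?a + - \<gamma> * ?b + - \<kappa> * ?c \<le> - \<delta> * norm (x - y) + (- \<delta> * ?a + - \<delta> * ?b)"
          by (simp add: algebra_simps)
        then show ?thesis using C st by (intro mult_left_mono) auto
      qed
      also have "\<dots> = P * E p"
        by (simp only: exp_add P_def E_def p prod.case mult.assoc)
      finally show ?thesis .
    qed
    have E: "E summable_on UNIV" "infsum E UNIV \<le> exp \<delta> * (lat_sum \<delta>)\<^sup>2"
      unfolding E_def by (rule summable_exp_pair [OF \<delta>(1)], rule infsum_exp_pair_le [OF \<delta>(1)])
    have PE: "((\<lambda>p. P * E p) has_sum P * infsum E UNIV) UNIV"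
      by (intro has_sum_cmult_right has_sum_infsum E)
    have "F summable_on UNIV"
      by (rule abs_summable_summable, rule summable_on_comparison_test [OF has_sum_imp_summable [OF PE]])
        (use term_le in auto)
    then have "norm (infsum F UNIV) \<le> P * infsum E UNIV"
      by (intro norm_infsum_le [OF _ PE term_le] has_sum_infsum)
    also have "\<dots> \<le> P * (exp \<delta> * (lat_sum \<delta>)\<^sup>2)"
      by (intro mult_left_mono E P)
    also have "\<dots> = exp (- \<delta> * norm (x - y)) * (D / (s * t))"
      by (simp add: P_def D_def)
    finally have sum: "norm (infsum F UNIV) \<le> exp (- \<delta> * norm (x - y)) * (D / (s * t))" .
    have "\<delta> \<le> \<kappa>" using \<delta> by simp
    then have "exp (- \<kappa> * norm (x - y)) \<le> exp (- \<delta> * norm (x - y))"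
      by (simp add: mult_right_mono)
    then have "exp (- \<kappa> * norm (x - y)) / norm (x - y) \<le> exp (- \<delta> * norm (x - y)) / norm (x - y)"
      by (intro divide_right_mono) auto
    then have "cmod (G0 x y z) \<le> exp (- \<delta> * norm (x - y)) * (1 / norm (x - y))"
      using norm_G0_le [of "norm (x - y)" x y z, folded \<kappa>_def] xy by simp
    then have "cmod (Green_formula \<omega> x y z) \<le> exp (- \<delta> * norm (x - y)) * (1 / norm (x - y))
        + exp (- \<delta> * norm (x - y)) * (D / (s * t))"
      unfolding Green_formula_def F_def [symmetric] using sum by (intro norm_triangle_le add_mono)
    then show "cmod (Green_formula \<omega> x y z) \<le> exp (- \<delta> * norm (x - y)) * (1 / norm (x - y) + D / (s * t))"
      by (simp only: distrib_left)
  qed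
qed

text \<open>The shape of the integrand serves both integrations: over \<open>y\<close> with the
  singularities \<open>a\<close> and 0, over \<open>x\<close> with \<open>p = 0\<close>.\<close>

lemma unit_cube_integral_affine_le:
  assumes K: "\<And>a. (\<integral>\<^sup>+y\<in>unit_cube. ennreal (1 / norm (a - y)) \<partial>lborel) \<le> ennreal K" "K \<ge> 0"
    and pq: "p \<ge> 0" "q \<ge> 0"
  shows "(\<integral>\<^sup>+y\<in>unit_cube. ennreal (p * (1 / norm (a - y)) + q * (1 / norm y)) \<partial>lborel) \<le> ennreal (p * K + q * K)"
proof -
  have split: "ennreal (p * A + q * A') * I = ennreal p * (ennreal A * I) + ennreal q * (ennreal A' * I)"
    if "A \<ge> 0" "A' \<ge> 0" for A A' I
    using pq that by (simp add: ennreal_plus ennreal_mult distrib_right mult.assoc)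
  have "(\<integral>\<^sup>+y\<in>unit_cube. ennreal (p * (1 / norm (a - y)) + q * (1 / norm y)) \<partial>lborel)
      = (\<integral>\<^sup>+y. ennreal p * (ennreal (1 / norm (a - y)) * indicator unit_cube y)
          + ennreal q * (ennreal (1 / norm (0 - y)) * indicator unit_cube y) \<partial>lborel)"
    by (intro nn_integral_cong, subst split) auto
  also have "\<dots> = ennreal p * (\<integral>\<^sup>+y\<in>unit_cube. ennreal (1 / norm (a - y)) \<partial>lborel)
      + ennreal q * (\<integral>\<^sup>+y\<in>unit_cube. ennreal (1 / norm (0 - y)) \<partial>lborel)"
    by (simp add: nn_integral_add nn_integral_cmult)
  also have "\<dots> \<le> ennreal p * ennreal K + ennreal q * ennreal K"
    by (intro add_mono mult_left_mono K) auto
  finally show ?thesis using pq K(2) by (simp add: ennreal_mult ennreal_plus)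
qed

lemma AE_notin_shifted_lattice: "AE x in lborel. x + lat m \<notin> lattice"
proof -
  have "countable (lat ` UNIV)" by simp
  then have "countable ((\<lambda>p. p - lat m) ` lattice)" by simp
  then have "(\<lambda>p. p - lat m) ` lattice \<in> null_sets lborel" by (rule countable_imp_null_set_lborel)
  then have "AE x in lborel. x \<notin> (\<lambda>p. p - lat m) ` lattice" by (rule AE_not_in)
  then show ?thesis
  proof eventually_elim
    case (elim x)
    then show ?case by (metis add_diff_cancel_right' imageI)
  qed
qed

theorem theorem2p4:
  fixes \<omega> :: "int ^ 3 \<Rightarrow> real" and a b f g :: real
    and H :: L2_operator
    and G :: "real ^ 3 \<Rightarrow> real ^ 3 \<Rightarrow> complex \<Rightarrow> complex"
  assumes "0 < a" "a < b" "0 < f" "f < g"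
    and "\<And>j. \<omega> j \<in> {-b..-a} \<union> {f..g}"
    and "delta_hamiltonian \<omega> H G"
  shows "\<forall>z. Im z > 0 \<longrightarrow>
    (\<exists>C \<gamma> :: real. C > 0 \<and> \<gamma> > 0 \<and>
      (\<forall>x y. x \<notin> lattice \<and> y \<notin> lattice \<and> norm (x - y) \<ge> 1 \<longrightarrow>
         cmod (G x y z) \<le> C / (infdist x lattice * infdist y lattice) * exp (- \<gamma> * norm (x - y))) \<and>
      (\<forall>m n :: int ^ 3.
         (\<integral>\<^sup>+x\<in>unit_cube. (\<integral>\<^sup>+y\<in>unit_cube. ennreal (cmod (G (x + lat m) (y + lat n) z)) \<partial>lborel) \<partial>lborel)
           \<le> ennreal (C * exp (- \<gamma> * norm (lat n - lat m)))))"
proof (intro allI impI)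
  fix z :: complex assume z: "Im z > 0"
  have G: "G x y z = Green_formula \<omega> x y z" if "x \<noteq> y" "x \<notin> lattice" "y \<notin> lattice" for x y
    using assms(6) z that by (simp add: delta_hamiltonian_def)
  \<comment> \<open>The sum covers both intervals regardless of the sign of
    \<open>\<omega> j\<close>; being bounded away from 0 is what the estimates use of the
    configuration.\<close>
  have B: "\<bar>1 / \<omega> j\<bar> \<le> 1 / a + 1 / f" for j
  proof -
    have "\<bar>\<omega> j\<bar> \<ge> a \<or> \<bar>\<omega> j\<bar> \<ge> f" using assms(1,3) assms(5) [of j] by auto
    then have "\<bar>1 / \<omega> j\<bar> \<le> 1 / a \<or> \<bar>1 / \<omega> j\<bar> \<le> 1 / f"
      using assms(1,3) by (auto simp: abs_divide intro!: divide_left_mono mult_pos_pos)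
    then show ?thesis using assms(1,3) by (smt (verit) zero_less_divide_1_iff)
  qed
  obtain D \<delta> where D: "D > 0" "\<delta> > 0" and bound:
    "\<And>x y s t. s > 0 \<Longrightarrow> t > 0 \<Longrightarrow> x \<noteq> y \<Longrightarrow> (\<And>i. s \<le> norm (x - lat i)) \<Longrightarrow> (\<And>i. t \<le> norm (y - lat i)) \<Longrightarrow>
      cmod (Green_formula \<omega> x y z) \<le> exp (- \<delta> * norm (x - y)) * (1 / norm (x - y) + D / (s * t))"
    using Green_formula_bound [where \<omega> = \<omega>, OF z B] by blast
  obtain K V where KV: "K \<ge> 0" "V \<ge> 0" "emeasure lborel unit_cube = ennreal V"
    and K: "\<And>a. (\<integral>\<^sup>+y\<in>unit_cube. ennreal (1 / norm (a - y)) \<partial>lborel) \<le> ennreal K"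
    by (rule unit_cube_integral_bounds) (rule that)
  \<comment> \<open>The part \<open>1 + D\<close> serves the pointwise bound, the last summand the
    integral; \<open>exp (2 * \<delta>)\<close> accounts for the displacement of at most 1 within
    each cube.\<close>
  define C where "C = 1 + D + exp (2 * \<delta>) * (K * V + D * K * K)"
  have C: "C \<ge> 1 + D" "C \<ge> exp (2 * \<delta>) * (K * V + D * K * K)"
    using D KV by (auto simp: C_def)
  have pointwise: "cmod (G x y z) \<le> C / (infdist x lattice * infdist y lattice) * exp (- \<delta> * norm (x - y))"
    if xy: "x \<notin> lattice" "y \<notin> lattice" "norm (x - y) \<ge> 1" for x y
  proof -
    define s where "s = infdist x lattice"
    define t where "t = infdist y lattice"
    have s: "s > 0" "s \<le> 1" "\<And>i. s \<le> norm (x - lat i)"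
      using xy infdist_lattice by (auto simp: s_def)
    have t: "t > 0" "t \<le> 1" "\<And>i. t \<le> norm (y - lat i)"
      using xy infdist_lattice by (auto simp: t_def)
    have "x \<noteq> y" using xy(3) by auto
    have st: "s * t > 0" "s * t \<le> 1" using s t by (auto simp: mult_le_one)
    have "1 / norm (x - y) \<le> 1" using xy(3) by (simp add: divide_le_eq)
    \<comment> \<open>Lattice distances never exceed 1, so the free Green function fits under the
      same denominator.\<close>
    also have "1 \<le> 1 / (s * t)" using st by simp
    finally have "1 / norm (x - y) + D / (s * t) \<le> (1 + D) / (s * t)" by (simp add: add_divide_distrib)
    also have "\<dots> \<le> C / (s * t)" using C st by (intro divide_right_mono) auto
    finally have "exp (- \<delta> * norm (x - y)) * (1 / norm (x - y) + D / (s * t)) \<le> exp (- \<delta> * norm (x - y)) * (C / (s * t))"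
      by (intro mult_left_mono) auto
    then show ?thesis
      using bound [OF s(1) t(1) \<open>x \<noteq> y\<close> s(3) t(3)] G [OF \<open>x \<noteq> y\<close> xy(1,2)]
      by (simp add: s_def t_def mult.commute)
  qed
  have integral: "(\<integral>\<^sup>+x\<in>unit_cube. (\<integral>\<^sup>+y\<in>unit_cube. ennreal (cmod (G (x + lat m) (y + lat n) z)) \<partial>lborel) \<partial>lborel)
           \<le> ennreal (C * exp (- \<delta> * norm (lat n - lat m)))" for m n
  proof -
    define P where "P = exp (2 * \<delta>) * exp (- \<delta> * norm (lat n - lat m))"
    have P: "P > 0" by (simp add: P_def)
    have inner: "(\<integral>\<^sup>+y\<in>unit_cube. ennreal (cmod (G (x + lat m) (y + lat n) z)) \<partial>lborel)
        \<le> ennreal (P * K + P * D / norm x * K)" if x: "x \<in> unit_cube" "x + lat m \<notin> lattice" for x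
    proof -
      define c where "c = x + lat m - lat n"
      have x0: "norm x > 0" using x(2) by auto
      \<comment> \<open>The formula for the kernel is available off the diagonal and off the
        lattice: the excluded \<open>y\<close> are the point \<open>c\<close>, where the arguments
        coincide, and a countable set.\<close>
      have "AE y in lborel. ennreal (cmod (G (x + lat m) (y + lat n) z)) * indicator unit_cube y
          \<le> ennreal (P * (1 / norm (c - y)) + P * D / norm x * (1 / norm y)) * indicator unit_cube y"
        using AE_notin_shifted_lattice [of n] AE_lborel_singleton [of c]
      proof eventually_elim
        case (elim y)
        show ?case
        proof (cases "y \<in> unit_cube")
          case True
          have y0: "norm y > 0" using elim(1) by auto
          have cy: "(x + lat m) - (y + lat n) = c - y" by (simp add: c_def)
          have ne: "x + lat m \<noteq> y + lat n" 
          proof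
            assume "x + lat m = y + lat n"
            then have "c = y" unfolding c_def by (simp only: add_diff_cancel_right')
            then show False using elim(2) by simp
          qed
          \<comment> \<open>The lattice is invariant under the shift by \<open>lat k\<close>, so the
            shifted point keeps the lattice distance bound \<open>norm p\<close>.\<close>
          have far: "norm p \<le> norm (p + lat k - lat i)" if "p \<in> unit_cube" for p k i
            using norm_le_dist_lattice [OF that, of "i - k"] by (simp add: lat_diff algebra_simps)
          have "norm (lat n - lat m) \<le> norm (c - y) + (norm x + norm y)"
          proof -
            have eq: "lat n - lat m = (x - y) - (c - y)" by (simp add: c_def)
            show ?thesis
              unfolding eq using norm_triangle_ineq4 [of "x - y" "c - y"] norm_triangle_ineq4 [of x y] by linarith
          qed
          then have "norm (lat n - lat m) - 2 \<le> norm (c - y)"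
            using norm_unit_cube_le [OF x(1)] norm_unit_cube_le [OF True] by linarith
          then have "\<delta> * (norm (lat n - lat m) - 2) \<le> \<delta> * norm (c - y)"
            using D by (intro mult_left_mono) auto
          then have eP: "exp (- \<delta> * norm (c - y)) \<le> P"
            unfolding P_def exp_add [symmetric] by (simp add: algebra_simps)
          have "cmod (G (x + lat m) (y + lat n) z)
              \<le> exp (- \<delta> * norm (c - y)) * (1 / norm (c - y) + D / (norm x * norm y))"
            using bound [OF x0 y0 ne far [OF x(1)] far [OF True]] G [OF ne x(2) elim(1)] by (simp add: cy)
          also have "\<dots> \<le> P * (1 / norm (c - y) + D / (norm x * norm y))"
            using eP D by (intro mult_right_mono) auto
          also have "\<dots> = P * (1 / norm (c - y)) + P * D / norm x * (1 / norm y)"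
            by (simp add: distrib_left)
          finally show ?thesis using True by (simp add: ennreal_leI)
        qed simp
      qed
      then have "(\<integral>\<^sup>+y\<in>unit_cube. ennreal (cmod (G (x + lat m) (y + lat n) z)) \<partial>lborel)
          \<le> (\<integral>\<^sup>+y\<in>unit_cube. ennreal (P * (1 / norm (c - y)) + P * D / norm x * (1 / norm y)) \<partial>lborel)"
        by (rule nn_integral_mono_AE)
      also have "\<dots> \<le> ennreal (P * K + P * D / norm x * K)"
        using P D KV by (intro unit_cube_integral_affine_le K) auto
      finally show ?thesis .
    qed
    \<comment> \<open>The summand with coefficient 0 brings the bound into the form of the affine
      integral lemma with \<open>p = 0\<close>; the constant \<open>P * K\<close> is integrated
      separately against the volume.\<close>
    have "AE x in lborel. (\<integral>\<^sup>+y\<in>unit_cube. ennreal (cmod (G (x + lat m) (y + lat n) z)) \<partial>lborel) * indicator unit_cube x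
        \<le> ennreal (P * K) * indicator unit_cube x
          + ennreal (0 * (1 / norm (0 - x)) + P * D * K * (1 / norm x)) * indicator unit_cube x"
      using AE_notin_shifted_lattice [of m]
    proof eventually_elim
      case (elim x)
      have "ennreal (P * K + P * D / norm x * K) = ennreal (P * K) + ennreal (0 * (1 / norm (0 - x)) + P * D * K * (1 / norm x))"
        using P D KV by (subst ennreal_plus [symmetric]) (auto simp: mult_ac)
      then show ?case using inner [OF _ elim] by (auto simp: indicator_def)
    qed
    then have "(\<integral>\<^sup>+x\<in>unit_cube. (\<integral>\<^sup>+y\<in>unit_cube. ennreal (cmod (G (x + lat m) (y + lat n) z)) \<partial>lborel) \<partial>lborel)
        \<le> (\<integral>\<^sup>+x. ennreal (P * K) * indicator unit_cube x
          + ennreal (0 * (1 / norm (0 - x)) + P * D * K * (1 / norm x)) * indicator unit_cube x \<partial>lborel)"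
      by (rule nn_integral_mono_AE)
    also have "\<dots> = ennreal (P * K) * emeasure lborel unit_cube
        + (\<integral>\<^sup>+x\<in>unit_cube. ennreal (0 * (1 / norm (0 - x)) + P * D * K * (1 / norm x)) \<partial>lborel)"
      by (subst nn_integral_add) (auto simp: nn_integral_cmult_indicator)
    also have "\<dots> \<le> ennreal (P * K) * ennreal V + ennreal (0 * K + P * D * K * K)"
      using P D KV by (intro add_mono unit_cube_integral_affine_le K) auto
    also have "\<dots> = ennreal (P * (K * V + D * K * K))"
      using P D KV by (simp add: ennreal_mult [symmetric] ennreal_plus [symmetric] algebra_simps del: ennreal_plus)
    also have "\<dots> \<le> ennreal (C * exp (- \<delta> * norm (lat n - lat m)))"
    proof (rule ennreal_leI)
      have "P * (K * V + D * K * K) = exp (2 * \<delta>) * (K * V + D * K * K) * exp (- \<delta> * norm (lat n - lat m))"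
        by (simp add: P_def)
      also have "\<dots> \<le> C * exp (- \<delta> * norm (lat n - lat m))"
        by (intro mult_right_mono C) auto
      finally show "P * (K * V + D * K * K) \<le> C * exp (- \<delta> * norm (lat n - lat m))" .
    qed
    finally show ?thesis .
  qed
  show "\<exists>C \<gamma> :: real. C > 0 \<and> \<gamma> > 0 \<and>
      (\<forall>x y. x \<notin> lattice \<and> y \<notin> lattice \<and> norm (x - y) \<ge> 1 \<longrightarrow>
         cmod (G x y z) \<le> C / (infdist x lattice * infdist y lattice) * exp (- \<gamma> * norm (x - y))) \<and>
      (\<forall>m n :: int ^ 3.
         (\<integral>\<^sup>+x\<in>unit_cube. (\<integral>\<^sup>+y\<in>unit_cube. ennreal (cmod (G (x + lat m) (y + lat n) z)) \<partial>lborel) \<partial>lborel)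
           \<le> ennreal (C * exp (- \<gamma> * norm (lat n - lat m))))"
    using C D pointwise integral by (intro exI [of _ C] exI [of _ \<delta>]) auto
qed

end
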